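(* Let $W$ be a finite dimensional complex vector space, let $G<\operatorname{GL}(W)$ be a finite group and let $\chi\colon G\to\mathbb{C}^*$ be a character (group homomorphism). Let $V=\bigoplus_{d\ge0}V_d$ be the graded $G$-module of polynomial vector fields on $W$ with zero divergence, and let $V^\chi$ be its graded subspace of $G$-semi-invariants with character $\chi$. Then the Poincaré series of $V^{\chi}$ is \[ P(V^{\chi};t)=\frac{1}{|G|}\sum_{\varphi\in G}\frac{\chi(\varphi)\left(\operatorname{tr}(\varphi^{-1})-t\right)}{\det(I-t\varphi)}. \]
   Context: For a graded complex vector space $M=\bigoplus_{d\ge 0}M_d$ with all $\dim_{\mathbb{C}}M_d<\infty$, the Poincaré series is $P(M;t)=\sum_{d\ge0}\dim_{\mathbb{C}}(M_d)t^d$. $V_d$ is the space of vector fields on $W$ with homogeneous polynomial coefficients of degree $d$ (i.e. elements of $S^d(W^\vee)\otimes W$) whose divergence (with respect to a constant volume form on $W$) is zero. $G$ acts on $V$ by pushforward, $\varphi\cdot v=\varphi_*v=\varphi\cdot(v\circ\varphi^{-1})$, and $V^\chi=\{v\in V\colon \varphi_*v=\chi(\varphi)v \text{ for all }\varphi\in G\}$. The identity is one of formal power series in $t$ (the right side being expanded at $t=0$).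
   Formalization: The vector space W is taken to be nonzero; for W = 0 the printed formula fails, since the left side is 0 and the right side is -t. *)

theory Defs
  imports "HOL-Analysis.Analysis" "HOL-Computational_Algebra.Formal_Power_Series"
    "HOL-Library.Function_Algebras" "HOL-Algebra.Group"
begin

text \<open>
  The complex vector space \<open>W\<close> is a type \<open>'w\<close> with a scalar multiplication \<open>s\<close>.  A basis of \<open>W\<close>
  is an injective family \<open>e\<close>, indexed by a finite type, whose range is a basis.  It is used to
  form traces, determinants and divergences, none of which depends on it.
  Index types are nonempty, so \<open>W \<noteq> 0\<close>.  For \<open>W = 0\<close> there are no nonzero fields, while the
  right-hand side of the Poincare series formula would be \<open>-t\<close>.
\<close>

definition coord :: "(complex \<Rightarrow> 'w::ab_group_add \<Rightarrow> 'w) \<Rightarrow> ('n::finite \<Rightarrow> 'w) \<Rightarrow> 'n \<Rightarrow> 'w \<Rightarrow> complex"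
  where "coord s e i w = module.representation s (range e) w (e i)"

definition matrix_of ::
    "(complex \<Rightarrow> 'w::ab_group_add \<Rightarrow> 'w) \<Rightarrow> ('n::finite \<Rightarrow> 'w) \<Rightarrow> ('w \<Rightarrow> 'w) \<Rightarrow> complex ^ 'n ^ 'n"
  where "matrix_of s e \<phi> = (\<chi> i j. coord s e i (\<phi> (e j)))"

definition GL :: "(complex \<Rightarrow> 'w::ab_group_add \<Rightarrow> 'w) \<Rightarrow> ('w \<Rightarrow> 'w) monoid"
  where "GL s = \<lparr>carrier = {\<phi>. Vector_Spaces.linear s s \<phi> \<and> bij \<phi>}, mult = (\<circ>), one = id\<rparr>"

definition complex_star :: "complex monoid"
  where "complex_star = \<lparr>carrier = UNIV - {0}, mult = (*), one = 1\<rparr>"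

definition fscale :: "(complex \<Rightarrow> 'b \<Rightarrow> 'b) \<Rightarrow> complex \<Rightarrow> ('a \<Rightarrow> 'b) \<Rightarrow> 'a \<Rightarrow> 'b"
  where "fscale s c f = (\<lambda>w. s c (f w))"

text \<open>
  \<open>S\<^sup>d(W\<^sup>\<or>)\<close> and \<open>S\<^sup>d(W\<^sup>\<or>) \<otimes> W\<close>, as spaces of functions on \<open>W\<close>: over \<open>\<complex>\<close> a polynomial (or a vector
  field with polynomial coefficients) is determined by its values.
\<close>

definition hom_poly :: "(complex \<Rightarrow> 'w::ab_group_add \<Rightarrow> 'w) \<Rightarrow> nat \<Rightarrow> ('w \<Rightarrow> complex) set"
  where "hom_poly s d = module.span (fscale (*))
    {(\<lambda>w. \<Prod>k<d. l k w) | l. \<forall>k<d. Vector_Spaces.linear s (*) (l k)}"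

definition hom_field :: "(complex \<Rightarrow> 'w::ab_group_add \<Rightarrow> 'w) \<Rightarrow> nat \<Rightarrow> ('w \<Rightarrow> 'w) set"
  where "hom_field s d = module.span (fscale s) {(\<lambda>w. s (f w) u) | f u. f \<in> hom_poly s d}"

text \<open>
  The divergence with respect to a constant volume form: the sum of the partial derivatives
  \<open>\<partial>v\<^sub>i/\<partial>x\<^sub>i\<close> in linear coordinates.
\<close>

definition divergence ::
    "(complex \<Rightarrow> 'w::ab_group_add \<Rightarrow> 'w) \<Rightarrow> ('n::finite \<Rightarrow> 'w) \<Rightarrow> ('w \<Rightarrow> 'w) \<Rightarrow> 'w \<Rightarrow> complex"
  where "divergence s e v w = (\<Sum>i\<in>UNIV. deriv (\<lambda>z. coord s e i (v (w + s z (e i)))) 0)"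

definition div_free ::
    "(complex \<Rightarrow> 'w::ab_group_add \<Rightarrow> 'w) \<Rightarrow> ('n::finite \<Rightarrow> 'w) \<Rightarrow> nat \<Rightarrow> ('w \<Rightarrow> 'w) set"
  where "div_free s e d = {v \<in> hom_field s d. \<forall>w. divergence s e v w = 0}"

definition pushforward :: "('w \<Rightarrow> 'w) \<Rightarrow> ('w \<Rightarrow> 'w) \<Rightarrow> 'w \<Rightarrow> 'w"
  where "pushforward \<phi> v = \<phi> \<circ> (v \<circ> inv_into UNIV \<phi>)"

definition semi_invariants ::
    "(complex \<Rightarrow> 'w \<Rightarrow> 'w) \<Rightarrow> ('w \<Rightarrow> 'w) set \<Rightarrow> (('w \<Rightarrow> 'w) \<Rightarrow> complex) \<Rightarrow>
      (nat \<Rightarrow> ('w \<Rightarrow> 'w) set) \<Rightarrow> nat \<Rightarrow> ('w \<Rightarrow> 'w) set"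
  where "semi_invariants s G c V d = {v \<in> V d. \<forall>\<phi>\<in>G. pushforward \<phi> v = fscale s (c \<phi>) v}"

definition poincare_series :: "(complex \<Rightarrow> 'm::ab_group_add \<Rightarrow> 'm) \<Rightarrow> (nat \<Rightarrow> 'm set) \<Rightarrow> complex fps"
  where "poincare_series s M = Abs_fps (\<lambda>d. of_nat (vector_space.dim s (M d)))"

text \<open>\<open>det(I - tA)\<close>; as a power series it has constant coefficient 1, so one may divide by it.\<close>

definition det_one_minus :: "complex ^ 'n ^ 'n \<Rightarrow> complex fps"
  where "det_one_minus A = det (\<chi> i j. mat 1 $ i $ j - fps_X * fps_const (A $ i $ j))"

end

(*
  Let n = dim W, let H_d be the space of all homogeneous fields of degree d, and let E be the
  Euler field.  For a polynomial f of degree d - 1 one has div (f E) = (d - 1 + n) f, so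
  v - (div v) E / (d - 1 + n) is a G-equivariant projection of H_d onto V_d.  Composing it with the
  average of c(phi) (phi^-1)_* over G projects H_d onto the semi-invariants of V_d.  The dimension
  is the trace of this projection, and cyclicity of the trace turns the term coming from E into the
  trace of f |-> f o phi on polynomials of degree d - 1.  As phi has finite order, W has a basis of
  eigenvectors of phi; the monomials (monomial fields) in it are eigenvectors, so that the traces
  are h_d(lambda) and tr(phi^-1) h_d(lambda), where the complete homogeneous symmetric polynomials
  h_d of the eigenvalues have the generating function 1 / det(I - t phi).
*)

theory Submission imports Defs
begin

section \<open>Traces with respect to a basis\<close>

text \<open>The weight \<open>c \<phi>\<close> goes with the inverse because a semi-invariant
  satisfies \<open>pushforward \<phi> v = fscale s (c \<phi>) v\<close>, so that c(phi) (phi^-1)_* v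
  = v. Since (phi^-1)_* v is phi^-1 o v o phi, coefficients are composed with phi itself: this gives
  det(I - t phi) in the denominator, while the vector part gives tr(phi^-1). The Euler field is
  fixed by all of GL(W), so its term has no factor tr(phi^-1), and its shift by one degree is the
  -t. The obstacle is that every map here is a total function on an infinite dimensional function
  space, and \<open>divergence\<close>, being built from \<open>deriv\<close>, is shown to be
  additive only on polynomial fields. Hence traces are taken with respect to finite bases, linearity
  is assumed on their spans only, and inductions carry membership in \<open>hom_poly\<close> or
  \<open>hom_field\<close> along. Polynomials are functions too, so the independence of monomials
  has to be proved; averaging over roots of unity does that.\<close>

lemma (in vector_space) independent_family:
  assumes "finite I" and indep: "\<And>a. (\<Sum>i\<in>I. scale (a i) (v i)) = 0 \<Longrightarrow> \<forall>i\<in>I. a i = 0"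
  shows "inj_on v I" and "independent (v ` I)"
proof -
  show inj: "inj_on v I"
  proof (rule inj_onI, rule ccontr)
    fix i j assume ij: "i \<in> I" "j \<in> I" "v i = v j" "i \<noteq> j"
    \<comment> \<open>A repeated vector is a relation with coefficients 1 and -1 at two distinct
      indices.\<close>
    define a :: "_ \<Rightarrow> 'a" where "a k = (if k = i then 1 else 0) - (if k = j then 1 else 0)" for k
    have "(\<Sum>k\<in>I. scale (a k) (v k)) = (\<Sum>k\<in>I. if k = i then v k else 0) - (\<Sum>k\<in>I. if k = j then v k else 0)"
      unfolding sum_subtractf[symmetric] by (rule sum.cong) (auto simp: a_def scale_left_diff_distrib)
    also have "\<dots> = 0" using ij \<open>finite I\<close> by simp
    finally show False using indep[of a] ij by (auto simp: a_def)
  qed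
  show "independent (v ` I)"
    unfolding dependent_finite[OF finite_imageI[OF \<open>finite I\<close>]]
    using indep[of "u \<circ> v" for u] by (fastforce simp: sum.reindex[OF inj])
qed

text \<open>If \<open>T\<close> maps \<open>span B\<close> linearly to itself and \<open>B\<close>
  is a finite independent set, this is the trace of the restriction of \<open>T\<close> to
  \<open>span B\<close>, whatever \<open>T\<close> does elsewhere.\<close>

definition (in vector_space) trace_wrt :: "'b set \<Rightarrow> ('b \<Rightarrow> 'b) \<Rightarrow> 'a"
  where "trace_wrt B T = (\<Sum>b\<in>B. representation B (T b) b)"

text \<open>Linearity is assumed on a span only, so that the rule applies to the divergence.\<close>

lemma (in vector_space_pair) linear_on_span_sum:
  assumes add: "\<And>x y. x \<in> vs1.span B \<Longrightarrow> y \<in> vs1.span B \<Longrightarrow> f (x + y) = f x + f y"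
    and scale: "\<And>c x. x \<in> vs1.span B \<Longrightarrow> f (s1 c x) = s2 c (f x)"
    and "\<And>i. i \<in> I \<Longrightarrow> v i \<in> vs1.span B"
  shows "f (\<Sum>i\<in>I. s1 (a i) (v i)) = (\<Sum>i\<in>I. s2 (a i) (f (v i)))"
  using assms(3)
proof (induction I rule: infinite_finite_induct)
  case (insert i I)
  then show ?case
    by (simp add: add scale vs1.span_sum vs1.span_scale)
\<comment> \<open>Empty and infinite index sets both give the sum 0; \<open>f 0 = 0\<close> comes
  from scaling by 0.\<close>
qed (use scale[OF vs1.span_zero, of 0] in simp_all)

text \<open>Serves the base case of inductions over a span: the vectors that a linear map sends into
  a subspace are closed under linear combinations.\<close>

lemma (in vector_space_pair) subspace_preimage:
  assumes "\<And>x y. f (x + y) = f x + f y" "\<And>c x. f (s1 c x) = s2 c (f x)" "vs2.subspace S"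
  shows "vs1.subspace {x. f x \<in> S}"
proof -
  have "Vector_Spaces.linear s1 s2 f"
    unfolding Vector_Spaces.linear_iff
    using assms vs1.vector_space_axioms vs2.vector_space_axioms by simp
  then interpret f: Vector_Spaces.linear s1 s2 f .
  show ?thesis by (rule f.subspace_linear_preimage) (rule assms(3))
qed

text \<open>With f and g written as matrices in \<open>B\<close> and \<open>C\<close>, both traces
  are the same double sum of products of entries. The two spans may have different dimensions; later
  they consist of fields and of polynomials.\<close>

lemma (in vector_space_pair) trace_wrt_cyclic:
  assumes B: "vs1.independent B" "finite B" and C: "vs2.independent C" "finite C"
    and f: "\<And>x. x \<in> vs1.span B \<Longrightarrow> f x \<in> vs2.span C"
    and g: "\<And>x. x \<in> vs2.span C \<Longrightarrow> g x \<in> vs1.span B"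
    and fadd: "\<And>x y. x \<in> vs1.span B \<Longrightarrow> y \<in> vs1.span B \<Longrightarrow> f (x + y) = f x + f y"
    and fscale: "\<And>c x. x \<in> vs1.span B \<Longrightarrow> f (s1 c x) = s2 c (f x)"
    and gadd: "\<And>x y. x \<in> vs2.span C \<Longrightarrow> y \<in> vs2.span C \<Longrightarrow> g (x + y) = g x + g y"
    and gscale: "\<And>c x. x \<in> vs2.span C \<Longrightarrow> g (s2 c x) = s1 c (g x)"
  shows "vs1.trace_wrt B (\<lambda>x. g (f x)) = vs2.trace_wrt C (\<lambda>x. f (g x))"
proof -
  interpret rev: vector_space_pair s2 s1 ..
  have 1: "vs1.representation B (g (f b)) b
      = (\<Sum>c\<in>C. vs2.representation C (f b) c * vs1.representation B (g c) b)" if "b \<in> B" for b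
  proof -
    have "f b = (\<Sum>c\<in>C. s2 (vs2.representation C (f b) c) c)"
      using vs2.sum_representation_eq[OF C(1) f[OF vs1.span_base[OF that]] C(2)] by simp
    then have "g (f b) = g (\<Sum>c\<in>C. s2 (vs2.representation C (f b) c) c)" by simp
    also have "\<dots> = (\<Sum>c\<in>C. s1 (vs2.representation C (f b) c) (g c))"
      by (rule rev.linear_on_span_sum[OF gadd gscale]) (auto intro: vs2.span_base)
    finally show ?thesis
      by (simp add: vs1.representation_sum[OF B(1)] vs1.representation_scale[OF B(1)] g
          vs1.span_scale vs2.span_base)
  qed
  have 2: "vs2.representation C (f (g c)) c
      = (\<Sum>b\<in>B. vs1.representation B (g c) b * vs2.representation C (f b) c)" if "c \<in> C" for c
  proof -
    have "g c = (\<Sum>b\<in>B. s1 (vs1.representation B (g c) b) b)"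
      using vs1.sum_representation_eq[OF B(1) g[OF vs2.span_base[OF that]] B(2)] by simp
    then have "f (g c) = f (\<Sum>b\<in>B. s1 (vs1.representation B (g c) b) b)" by simp
    also have "\<dots> = (\<Sum>b\<in>B. s2 (vs1.representation B (g c) b) (f b))"
      by (rule linear_on_span_sum[OF fadd fscale]) (auto intro: vs1.span_base)
    finally show ?thesis
      by (simp add: vs2.representation_sum[OF C(1)] vs2.representation_scale[OF C(1)] f
          vs2.span_scale vs1.span_base)
  qed
  show ?thesis
    unfolding vs1.trace_wrt_def vs2.trace_wrt_def
    by (simp add: 1 2 sum.swap[of _ B C] mult.commute)
qed

context vector_space begin

lemma trace_wrt_cong:
  "(\<And>b. b \<in> B \<Longrightarrow> S b = T b) \<Longrightarrow> trace_wrt B S = trace_wrt B T"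
  by (simp add: trace_wrt_def)

text \<open>Cyclicity for \<open>T\<close> followed by the identity, read as a map from the span
  with basis \<open>C\<close> to the same span with basis \<open>B\<close>.\<close>

lemma trace_wrt_basis_change:
  assumes "independent B" "finite B" "independent C" "finite C" "span B = span C"
    and "\<And>x. x \<in> span B \<Longrightarrow> T x \<in> span B"
    and "\<And>x y. x \<in> span B \<Longrightarrow> y \<in> span B \<Longrightarrow> T (x + y) = T x + T y"
    and "\<And>c x. x \<in> span B \<Longrightarrow> T (scale c x) = scale c (T x)"
  shows "trace_wrt B T = trace_wrt C T"
proof -
  interpret vector_space_pair scale scale ..
  show ?thesis
    using trace_wrt_cyclic[of B C T "\<lambda>x. x"] assms by simp
qed

text \<open>In a basis of \<open>U\<close> extended to one of \<open>span B\<close>, the diagonal of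
  \<open>P\<close> is 1 on the basis of \<open>U\<close>, which is fixed, and 0 on the added
  vectors, whose images lie in \<open>U\<close>.\<close>

lemma trace_wrt_projection:
  assumes B: "independent B" "finite B" and U: "subspace U" "U \<subseteq> span B"
    and P: "\<And>x. x \<in> span B \<Longrightarrow> P x \<in> U" "\<And>x. x \<in> U \<Longrightarrow> P x = x"
    and lin: "\<And>x y. x \<in> span B \<Longrightarrow> y \<in> span B \<Longrightarrow> P (x + y) = P x + P y"
      "\<And>c x. x \<in> span B \<Longrightarrow> P (scale c x) = scale c (P x)"
  shows "trace_wrt B P = of_nat (dim U)"
proof -
  obtain C where C: "C \<subseteq> U" "independent C" "U \<subseteq> span C"
    using maximal_independent_subset .
  obtain D where D: "C \<subseteq> D" "D \<subseteq> span B" "independent D" "span B \<subseteq> span D"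
    using maximal_independent_subset_extend[of C "span B"] C U by blast
  have finD: "finite D" using independent_span_bound[OF B(2) D(3,2)] by simp
  have spanD: "span B = span D"
    using D span_minimal[OF D(2)] by auto
  have spanC: "span C = U" using C U span_subspace by blast
  have "trace_wrt B P = trace_wrt D P"
    by (rule trace_wrt_basis_change) (use B D finD spanD P U lin in auto)
  also have "\<dots> = (\<Sum>b\<in>D. if b \<in> C then 1 else 0)"
    unfolding trace_wrt_def
  proof (rule sum.cong)
    fix b assume b: "b \<in> D"
    have "P b \<in> span C" using P(1) b D spanC by blast
    then have "representation D (P b) = representation C (P b)"
      by (rule representation_extend[OF D(3) _ D(1)])
    then show "representation D (P b) b = (if b \<in> C then 1 else 0)"
      using P(2)[of b] C b representation_ne_zero[of C "P b" b]
      by (auto simp: representation_basis)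
  qed simp
  also have "\<dots> = of_nat (card C)"
    using D(1) finD by (simp add: sum.If_cases Int_absorb1)
  also have "card C = dim U"
    using dim_span_eq_card_independent[OF C(2)] spanC by simp
  finally show ?thesis .
qed

lemma trace_wrt_sum:
  assumes "independent B" "\<And>i b. i \<in> I \<Longrightarrow> b \<in> B \<Longrightarrow> T i b \<in> span B"
  shows "trace_wrt B (\<lambda>x. \<Sum>i\<in>I. scale (a i) (T i x)) = (\<Sum>i\<in>I. a i * trace_wrt B (T i))"
proof -
  have "representation B (\<Sum>i\<in>I. scale (a i) (T i b)) b = (\<Sum>i\<in>I. a i * representation B (T i b) b)"
    if "b \<in> B" for b
    using assms that by (simp add: representation_sum representation_scale span_scale)
  then show ?thesis
    by (simp add: trace_wrt_def sum.swap[of _ B I] sum_distrib_left)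
qed

lemma trace_wrt_diff:
  assumes "independent B" "\<And>b. b \<in> B \<Longrightarrow> S b \<in> span B" "\<And>b. b \<in> B \<Longrightarrow> T b \<in> span B"
  shows "trace_wrt B (\<lambda>x. S x - T x) = trace_wrt B S - trace_wrt B T"
  using assms by (simp add: trace_wrt_def representation_diff sum_subtractf)

lemma trace_wrt_eigenbasis:
  assumes "inj_on v I" "independent (v ` I)" "\<And>i. i \<in> I \<Longrightarrow> T (v i) = scale (a i) (v i)"
  shows "trace_wrt (v ` I) T = (\<Sum>i\<in>I. a i)"
  using assms by (simp add: trace_wrt_def sum.reindex representation_scale span_base representation_basis)

end

section \<open>Compositions, monomials and complete homogeneous sums\<close>

lemma ex_primitive_root_of_unity:
  assumes "N > 0"
  shows "\<exists>\<omega>::complex. \<forall>j. \<omega> ^ j = 1 \<longleftrightarrow> N dvd j"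
proof -
  have "exp (2 * of_real pi * \<i> / of_nat N) ^ j = 1 \<longleftrightarrow> N dvd j" for j
    using complex_root_unity_eq_1[of N j] assms
    by (simp add: exp_of_nat_mult[symmetric] mult_ac)
  then show ?thesis by blast
qed

lemma sum_powers_root_of_unity:
  fixes \<omega> :: complex
  assumes "\<And>j. \<omega> ^ j = 1 \<longleftrightarrow> N dvd j"
  shows "(\<Sum>k<N. \<omega> ^ (k * j)) = (if N dvd j then of_nat N else 0)"
proof (cases "N dvd j")
  case True
  then have "\<omega> ^ j = 1" using assms by simp
  then show ?thesis using True by (simp add: mult.commute[of _ j] power_mult)
next
  case False
  have "(\<omega> ^ j) ^ N = 1"
    using assms[of "j * N"] by (simp add: power_mult)
  moreover have "\<omega> ^ j \<noteq> 1" using False assms by simp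
  ultimately have "(\<Sum>k<N. (\<omega> ^ j) ^ k) = 0"
    by (subst geometric_sum) simp_all
  with False show ?thesis by (simp add: mult.commute[of _ j] power_mult)
qed

text \<open>Exponent vectors of the monomials of degree d in variables indexed by \<open>S\<close>.
  The value 0 outside \<open>S\<close> makes each vector a single function and lets vectors over
  \<open>S\<close> count as vectors over a larger set.\<close>

definition weak_compositions :: "'i set \<Rightarrow> nat \<Rightarrow> ('i \<Rightarrow> nat) set"
  where "weak_compositions S d = {\<alpha>. (\<forall>i. i \<notin> S \<longrightarrow> \<alpha> i = 0) \<and> sum \<alpha> S = d}"

lemma finite_weak_compositions:
  assumes "finite S"
  shows "finite (weak_compositions S d)"
proof (rule finite_subset)
  show "weak_compositions S d \<subseteq> {\<alpha>. \<forall>i. (i \<in> S \<longrightarrow> \<alpha> i \<in> {..d}) \<and> (i \<notin> S \<longrightarrow> \<alpha> i = 0)}"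
    using assms by (auto simp: weak_compositions_def intro: member_le_sum)
  show "finite {\<alpha>. \<forall>i. (i \<in> S \<longrightarrow> \<alpha> i \<in> {..d}) \<and> (i \<notin> S \<longrightarrow> \<alpha> i = 0)}"
    using assms by (intro finite_set_of_finite_funs) auto
qed

lemma weak_compositions_0:
  "finite S \<Longrightarrow> weak_compositions S 0 = {\<lambda>_. 0}"
  by (auto simp: weak_compositions_def fun_eq_iff)

text \<open>Either the exponent at i is 0, or one factor of the variable i can be split off. This is
  the recursion behind the generating function.\<close>

lemma weak_compositions_insert_Suc:
  assumes "finite S" "i \<notin> S"
  shows "weak_compositions (insert i S) (Suc d) =
    weak_compositions S (Suc d) \<union> (\<lambda>\<alpha>. \<alpha>(i := Suc (\<alpha> i))) ` weak_compositions (insert i S) d"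
    (is "?L = ?R")
proof
  have sum_upd: "(\<Sum>j\<in>S. if j = i then k else \<alpha> j) = sum \<alpha> S" for \<alpha> :: "_ \<Rightarrow> nat" and k
    using assms by (intro sum.cong) auto
  show "?L \<subseteq> ?R"
  proof
    fix \<alpha> assume \<alpha>: "\<alpha> \<in> ?L"
    show "\<alpha> \<in> ?R"
    proof (cases "\<alpha> i")
      case 0
      then have "\<alpha> \<in> weak_compositions S (Suc d)"
        using \<alpha> assms by (force simp: weak_compositions_def)
      then show ?thesis ..
    next
      case (Suc k)
      then have "\<alpha> = (\<alpha>(i := k))(i := Suc ((\<alpha>(i := k)) i))" by auto
      moreover have "\<alpha>(i := k) \<in> weak_compositions (insert i S) d"
        using \<alpha> Suc assms by (auto simp: weak_compositions_def sum_upd fun_upd_def)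
      ultimately show ?thesis by blast
    qed
  qed
  show "?R \<subseteq> ?L"
    using assms by (auto simp: weak_compositions_def sum_upd fun_upd_def)
qed

text \<open>A new variable is removed by its own factor: the recursion on exponent vectors says that
  \<open>1 - fps_X * fps_const (\<mu> i)\<close> times the series for \<open>insert i S\<close> is
  the series for \<open>S\<close>. The product form avoids inverses, so any commutative ring will
  do.\<close>

lemma complete_homogeneous_generating_function:
  fixes \<mu> :: "'i \<Rightarrow> 'a::comm_ring_1"
  assumes "finite S"
  shows "(\<Prod>i\<in>S. 1 - fps_X * fps_const (\<mu> i)) *
    Abs_fps (\<lambda>d. \<Sum>\<alpha>\<in>weak_compositions S d. \<Prod>i\<in>S. \<mu> i ^ \<alpha> i) = 1"
  using assms
proof (induction S rule: finite_induct)
  case empty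
  have "weak_compositions {} d = (if d = 0 then {\<lambda>_. 0} else {} :: ('i \<Rightarrow> nat) set)" for d
    by (auto simp: weak_compositions_def fun_eq_iff)
  then show ?case by (auto simp: fps_eq_iff)
next
  case (insert i S)
  define H where "H S = Abs_fps (\<lambda>d. \<Sum>\<alpha>\<in>weak_compositions S d. \<Prod>i\<in>S. \<mu> i ^ \<alpha> i)" for S
  have "fps_nth (H (insert i S)) (Suc d) = fps_nth (H S) (Suc d) + \<mu> i * fps_nth (H (insert i S)) d" for d
  proof -
    let ?u = "\<lambda>\<alpha>::'i \<Rightarrow> nat. \<alpha>(i := Suc (\<alpha> i))"
    have inj: "inj_on ?u A" for A
    proof (intro inj_onI ext)
      fix \<alpha> \<beta> j assume "?u \<alpha> = ?u \<beta>"
      from fun_cong[OF this, of j] show "\<alpha> j = \<beta> j" by (cases "j = i") auto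
    qed
    have prod_upd: "(\<Prod>j\<in>S. \<mu> j ^ (if j = i then Suc (\<alpha> i) else \<alpha> j)) = (\<Prod>j\<in>S. \<mu> j ^ \<alpha> j)" for \<alpha>
      using insert.hyps by (intro prod.cong) auto
    have "fps_nth (H (insert i S)) (Suc d) =
        (\<Sum>\<alpha>\<in>weak_compositions S (Suc d). \<Prod>j\<in>insert i S. \<mu> j ^ \<alpha> j) +
        (\<Sum>\<alpha>\<in>?u ` weak_compositions (insert i S) d. \<Prod>j\<in>insert i S. \<mu> j ^ \<alpha> j)"
      unfolding H_def fps_nth_Abs_fps weak_compositions_insert_Suc[OF insert.hyps]
      using insert.hyps
      by (intro sum.union_disjoint finite_imageI finite_weak_compositions)
        (auto simp: weak_compositions_def)
    also have "(\<Sum>\<alpha>\<in>weak_compositions S (Suc d). \<Prod>j\<in>insert i S. \<mu> j ^ \<alpha> j) = fps_nth (H S) (Suc d)"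
      unfolding H_def fps_nth_Abs_fps
      using insert.hyps by (intro sum.cong) (auto simp: weak_compositions_def)
    also have "(\<Sum>\<alpha>\<in>?u ` weak_compositions (insert i S) d. \<Prod>j\<in>insert i S. \<mu> j ^ \<alpha> j) =
        \<mu> i * fps_nth (H (insert i S)) d"
      unfolding H_def fps_nth_Abs_fps sum.reindex[OF inj] sum_distrib_left o_def
      by (intro sum.cong) (simp_all add: insert.hyps prod_upd fun_upd_def mult_ac)
    finally show ?thesis .
  qed
  moreover have "fps_nth (H (insert i S)) 0 = fps_nth (H S) 0"
    using insert.hyps by (simp add: H_def weak_compositions_0)
  ultimately have step: "fps_nth ((1 - fps_X * fps_const (\<mu> i)) * H (insert i S)) d = fps_nth (H S) d" for d
    by (cases d) (simp_all add: left_diff_distrib mult.assoc)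
  have "(\<Prod>j\<in>insert i S. 1 - fps_X * fps_const (\<mu> j)) * H (insert i S) =
      (\<Prod>j\<in>S. 1 - fps_X * fps_const (\<mu> j)) * ((1 - fps_X * fps_const (\<mu> i)) * H (insert i S))"
    using insert.hyps by (simp add: mult_ac)
  also have "(1 - fps_X * fps_const (\<mu> i)) * H (insert i S) = H S"
    by (rule fps_ext) (rule step)
  finally show ?case
    using insert.IH by (simp only: H_def)
qed

text \<open>The coefficient of a monomial is extracted by averaging over tuples of \<open>N\<close>-th roots of
  unity, where \<open>N\<close> exceeds all exponents that occur.\<close>
lemma monomial_functions_independent:
  fixes A :: "('n::finite \<Rightarrow> nat) set" and a :: "('n \<Rightarrow> nat) \<Rightarrow> complex"
  assumes "finite A" and zero: "\<And>z. (\<Sum>\<alpha>\<in>A. a \<alpha> * (\<Prod>i\<in>UNIV. z i ^ \<alpha> i)) = 0"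
    and \<beta>: "\<beta> \<in> A"
  shows "a \<beta> = 0"
proof -
  define N where "N = Suc (\<Sum>\<alpha>\<in>A. \<Sum>i\<in>UNIV. \<alpha> i)"
  have less: "\<alpha> i < N" if "\<alpha> \<in> A" for \<alpha> i
  proof -
    have "\<alpha> i \<le> (\<Sum>i\<in>UNIV. \<alpha> i)" by (rule member_le_sum) auto
    also have "\<dots> \<le> (\<Sum>\<alpha>\<in>A. \<Sum>i\<in>UNIV. \<alpha> i)"
      by (rule member_le_sum[OF that, of "\<lambda>\<alpha>. \<Sum>i\<in>UNIV. \<alpha> i"]) (use \<open>finite A\<close> in auto)
    finally show ?thesis by (simp add: N_def)
  qed
  obtain \<omega> :: complex where \<omega>: "\<And>j. \<omega> ^ j = 1 \<longleftrightarrow> N dvd j"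
    using ex_primitive_root_of_unity[of N] by (auto simp: N_def)
  \<comment> \<open>\<open>N - \<beta> i + \<alpha> i\<close> stands for the difference of exponents
    modulo N without leaving the naturals. As both exponents are below N, it lies strictly between 0
    and 2N, where N is the only multiple of N.\<close>
  have dvd: "N dvd N - \<beta> i + \<alpha> i \<longleftrightarrow> \<alpha> i = \<beta> i" if "\<alpha> \<in> A" for \<alpha> i
  proof
    assume "N dvd N - \<beta> i + \<alpha> i"
    then obtain q where q: "N - \<beta> i + \<alpha> i = N * q" by blast
    have "0 < q" using q less[OF \<beta>, of i] by (cases q) auto
    moreover have "q < 2"
    proof (rule ccontr)
      assume "\<not> q < 2"
      then have "N * 2 \<le> N * q" by (intro mult_le_mono) auto
      then show False using q less[OF that, of i] by linarith
    qed
    ultimately have "q = 1" by linarith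
    then show "\<alpha> i = \<beta> i" using q less[OF \<beta>, of i] by simp
  qed (use less[OF \<beta>, of i] in simp)
  let ?K = "PiE UNIV (\<lambda>_::'n. {..<N})"
  have coeff: "(\<Sum>k\<in>?K. \<Prod>i\<in>UNIV. \<omega> ^ (k i * (N - \<beta> i + \<alpha> i))) =
      (if \<alpha> = \<beta> then of_nat N ^ CARD('n) else 0)" if "\<alpha> \<in> A" for \<alpha>
  proof -
    have "(\<Sum>k\<in>?K. \<Prod>i\<in>UNIV. \<omega> ^ (k i * (N - \<beta> i + \<alpha> i))) =
        (\<Prod>i\<in>UNIV. \<Sum>k<N. \<omega> ^ (k * (N - \<beta> i + \<alpha> i)))"
      by (subst prod_sum_PiE) auto
    also have "\<dots> = (\<Prod>i\<in>UNIV. if \<alpha> i = \<beta> i then of_nat N else 0)"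
      by (simp add: sum_powers_root_of_unity[OF \<omega>] dvd[OF that])
    also have "\<dots> = (if \<alpha> = \<beta> then of_nat N ^ CARD('n) else 0)"
      by (auto simp: fun_eq_iff)
    finally show ?thesis .
  qed
  \<comment> \<open>The relation is evaluated at the points with coordinates
    \<open>\<omega> ^ k i\<close> and weighted by the inverse of the value of the monomial \<beta>;
    summing over k leaves only the coefficient of \<beta>.\<close>
  have "0 = (\<Sum>k\<in>?K. (\<Prod>i\<in>UNIV. \<omega> ^ (k i * (N - \<beta> i))) *
      (\<Sum>\<alpha>\<in>A. a \<alpha> * (\<Prod>i\<in>UNIV. (\<omega> ^ k i) ^ \<alpha> i)))"
    by (simp add: zero)
  also have "\<dots> = (\<Sum>k\<in>?K. \<Sum>\<alpha>\<in>A. a \<alpha> * (\<Prod>i\<in>UNIV. \<omega> ^ (k i * (N - \<beta> i + \<alpha> i))))"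
    by (simp add: sum_distrib_left mult.left_commute[of _ "a _"] prod.distrib distrib_left power_add power_mult)
  also have "\<dots> = (\<Sum>\<alpha>\<in>A. a \<alpha> * (\<Sum>k\<in>?K. \<Prod>i\<in>UNIV. \<omega> ^ (k i * (N - \<beta> i + \<alpha> i))))"
    by (subst sum.swap) (simp add: sum_distrib_left)
  also have "\<dots> = a \<beta> * of_nat N ^ CARD('n)"
    using \<open>finite A\<close> \<beta> by (simp add: coeff if_distrib cong: if_cong)
  finally show ?thesis by (simp add: N_def del: of_nat_Suc)
qed

section \<open>Bases of monomials\<close>

lemma sum_fun_apply: "sum f A x = (\<Sum>a\<in>A. f a x)"
  by (induction A rule: infinite_finite_induct) simp_all

lemma fscale_apply: "fscale s c f x = s c (f x)"
  by (simp add: fscale_def)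

lemma vector_space_fscale:
  assumes "vector_space s"
  shows "vector_space (fscale s)"
proof -
  interpret vector_space s by fact
  show ?thesis
    by unfold_locales
      (simp_all add: fscale_def fun_eq_iff scale_right_distrib scale_left_distrib)
qed

lemma linear_inv:
  assumes "Vector_Spaces.linear s s \<phi>" "bij \<phi>"
  shows "Vector_Spaces.linear s s (inv_into UNIV \<phi>)"
  using assms bij_module_hom_imp_inv_module_hom[of s s \<phi>] by (simp add: module_hom_eq_linear)

lemma vector_space_complex: "vector_space ((*) :: complex \<Rightarrow> complex \<Rightarrow> complex)"
  by unfold_locales (simp_all add: algebra_simps)

text \<open>The basis is a parameter because the locale is used with two bases of the same space at
  once: the given one and a basis of eigenvectors. \<open>hom_poly\<close> and
  \<open>hom_field\<close> do not mention it, which is what links the two instances.\<close>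

locale indexed_basis = finite_dimensional_vector_space s "range e"
  for s :: "complex \<Rightarrow> 'w::ab_group_add \<Rightarrow> 'w" and e :: "'n::finite \<Rightarrow> 'w" +
  assumes inj_e: "inj e"
begin

sublocale fn: vector_space "fscale (*) :: complex \<Rightarrow> ('w \<Rightarrow> complex) \<Rightarrow> 'w \<Rightarrow> complex"
  by (rule vector_space_fscale[OF vector_space_complex])

sublocale fld: vector_space "fscale s :: complex \<Rightarrow> ('w \<Rightarrow> 'w) \<Rightarrow> 'w \<Rightarrow> 'w"
  by (rule vector_space_fscale) (rule vector_space_axioms)

sublocale fn_fn: vector_space_pair
  "fscale (*) :: complex \<Rightarrow> ('w \<Rightarrow> complex) \<Rightarrow> 'w \<Rightarrow> complex"
  "fscale (*) :: complex \<Rightarrow> ('w \<Rightarrow> complex) \<Rightarrow> 'w \<Rightarrow> complex" ..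

sublocale fn_fld: vector_space_pair
  "fscale (*) :: complex \<Rightarrow> ('w \<Rightarrow> complex) \<Rightarrow> 'w \<Rightarrow> complex"
  "fscale s :: complex \<Rightarrow> ('w \<Rightarrow> 'w) \<Rightarrow> 'w \<Rightarrow> 'w" ..

sublocale fld_fn: vector_space_pair
  "fscale s :: complex \<Rightarrow> ('w \<Rightarrow> 'w) \<Rightarrow> 'w \<Rightarrow> 'w"
  "fscale (*) :: complex \<Rightarrow> ('w \<Rightarrow> complex) \<Rightarrow> 'w \<Rightarrow> complex" ..

abbreviation "linear_form \<equiv> Vector_Spaces.linear s ((*) :: complex \<Rightarrow> complex \<Rightarrow> complex)"

lemma linear_formI:
  assumes "\<And>x y. l (x + y) = l x + l y" "\<And>c x. l (s c x) = c * l x"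
  shows "linear_form l"
  unfolding Vector_Spaces.linear_iff using assms vector_space_axioms vector_space_complex by simp

lemma linear_form_add: "linear_form l \<Longrightarrow> l (x + y) = l x + l y"
  and linear_form_scale: "linear_form l \<Longrightarrow> l (s c x) = c * l x"
  unfolding Vector_Spaces.linear_iff by simp_all

lemma in_span_basis: "w \<in> span (range e)"
  using span_Basis by simp

lemma coord_add: "coord s e i (v + w) = coord s e i v + coord s e i w"
  and coord_scale: "coord s e i (s c w) = c * coord s e i w"
  and coord_basis: "coord s e i (e j) = (if i = j then 1 else 0)"
  unfolding coord_def
  by (simp_all add: representation_add representation_scale representation_basis
      independent_Basis in_span_basis inj_eq[OF inj_e] del: span_Basis)

lemma linear_form_coord: "linear_form (coord s e i)"
  by (rule linear_formI) (rule coord_add coord_scale)+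

lemma sum_coord: "(\<Sum>i\<in>UNIV. s (coord s e i w) (e i)) = w"
  using sum_representation_eq[OF independent_Basis in_span_basis, of "range e" w]
  by (simp add: coord_def sum.reindex[OF inj_e])

lemma coord_sum: "coord s e i (sum f A) = (\<Sum>a\<in>A. coord s e i (f a))"
proof -
  interpret Vector_Spaces.linear s "(*)" "coord s e i" by (rule linear_form_coord)
  show ?thesis by (rule sum)
qed

lemma coord_zero: "coord s e i 0 = 0"
  using coord_scale[of i 0 0] by simp

lemma linear_form_expand:
  assumes "linear_form l"
  shows "l w = (\<Sum>i\<in>UNIV. l (e i) * coord s e i w)"
proof -
  interpret Vector_Spaces.linear s "(*)" l by fact
  have "l w = l (\<Sum>i\<in>UNIV. s (coord s e i w) (e i))" by (simp only: sum_coord)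
  also have "\<dots> = (\<Sum>i\<in>UNIV. l (e i) * coord s e i w)"
    by (simp add: sum scale mult.commute)
  finally show ?thesis .
qed

section \<open>Homogeneous polynomials and monomials\<close>

lemma subspace_hom_poly: "fn.subspace (hom_poly s d)"
  unfolding hom_poly_def by simp

lemma hom_poly_mult_linear:
  assumes "f \<in> hom_poly s d" "linear_form l"
  shows "(\<lambda>w. f w * l w) \<in> hom_poly s (Suc d)"
  using assms(1) unfolding hom_poly_def[of _ d]
proof (induction rule: fn.span_induct)
  case base
  show ?case
    by (rule fn_fn.subspace_preimage[OF _ _ subspace_hom_poly])
      (auto simp: fscale_def fun_eq_iff distrib_right)
next
  case (step f)
  then obtain l' where l': "f = (\<lambda>w. \<Prod>k<d. l' k w)" "\<forall>k<d. linear_form (l' k)" by blast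
  have "(\<lambda>w. f w * l w) = (\<lambda>w. \<Prod>k<Suc d. (l'(d := l)) k w)"
    by (simp add: l' fun_eq_iff)
  moreover have "\<forall>k<Suc d. linear_form ((l'(d := l)) k)"
    using l' assms(2) by (auto simp: less_Suc_eq)
  ultimately show ?case
    unfolding hom_poly_def by (intro fn.span_base) blast
qed

lemma one_hom_poly: "(\<lambda>_. 1) \<in> hom_poly s 0"
  unfolding hom_poly_def by (intro fn.span_base) simp

text \<open>Induction on the number of linear factors, with linear combinations handled at each
  degree by the case \<open>subspace\<close>. When that closure needs polynomials, as it does for
  derivatives, \<open>P\<close> must itself contain membership in \<open>hom_poly\<close>.\<close>

lemma hom_poly_induct [consumes 1, case_names subspace one mult]:
  assumes f: "f \<in> hom_poly s d"
    and sub: "\<And>d. fn.subspace {f. P d f}"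
    and one: "P 0 (\<lambda>_. 1)"
    and mult: "\<And>d f l. f \<in> hom_poly s d \<Longrightarrow> P d f \<Longrightarrow> linear_form l \<Longrightarrow> P (Suc d) (\<lambda>w. f w * l w)"
  shows "P d f"
  using f unfolding hom_poly_def
proof (induction rule: fn.span_induct)
  case (step f)
  then obtain l where l: "f = (\<lambda>w. \<Prod>k<d. l k w)" "\<forall>k<d. linear_form (l k)" by blast
  have "(\<lambda>w. \<Prod>k<d. l k w) \<in> hom_poly s d \<and> P d (\<lambda>w. \<Prod>k<d. l k w)"
    using l(2)
  proof (induction d)
    case (Suc d)
    then show ?case
      using hom_poly_mult_linear[of "\<lambda>w. \<Prod>k<d. l k w" d "l d"]
        mult[of "\<lambda>w. \<Prod>k<d. l k w" d "l d"] by simp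
  qed (simp add: one one_hom_poly)
  then show ?case by (simp add: l)
qed (rule sub)

definition monomial :: "('n \<Rightarrow> nat) \<Rightarrow> 'w \<Rightarrow> complex"
  where "monomial \<alpha> w = (\<Prod>i\<in>UNIV. coord s e i w ^ \<alpha> i)"

lemma monomial_mult_coord:
  "monomial \<alpha> w * coord s e i w = monomial (\<alpha>(i := Suc (\<alpha> i))) w"
proof -
  have "(\<Prod>j\<in>UNIV - {i}. coord s e j w ^ (\<alpha>(i := Suc (\<alpha> i))) j)
      = (\<Prod>j\<in>UNIV - {i}. coord s e j w ^ \<alpha> j)"
    by (rule prod.cong) auto
  then show ?thesis
    by (simp add: monomial_def prod.remove[of UNIV i])
qed

lemma fun_upd_Suc_in_weak_compositions:
  fixes \<alpha> :: "'n \<Rightarrow> nat"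
  assumes "\<alpha> \<in> weak_compositions UNIV d"
  shows "\<alpha>(i := Suc (\<alpha> i)) \<in> weak_compositions UNIV (Suc d)"
  using assms weak_compositions_insert_Suc[of "UNIV - {i}" i d] by (auto simp: insert_absorb)

lemma monomial_hom_poly:
  "\<alpha> \<in> weak_compositions UNIV d \<Longrightarrow> monomial \<alpha> \<in> hom_poly s d"
proof (induction d arbitrary: \<alpha>)
  case 0
  then show ?case
    using one_hom_poly by (simp add: weak_compositions_0 monomial_def[abs_def])
next
  case (Suc d)
  then obtain i where "\<alpha> i \<noteq> 0"
    by (force simp: weak_compositions_def)
  \<comment> \<open>A positive exponent at i excludes the first half of the recursion, so \<alpha>
    arises from a \<beta> of degree d by raising the exponent at i.\<close>
  then have i: "\<alpha> \<notin> weak_compositions (UNIV - {i}) (Suc d)"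
    by (auto simp: weak_compositions_def)
  then obtain \<beta> where \<beta>: "\<beta> \<in> weak_compositions UNIV d" "\<alpha> = \<beta>(i := Suc (\<beta> i))"
    using Suc.prems weak_compositions_insert_Suc[of "UNIV - {i}" i d]
    by (auto simp: insert_absorb)
  then show ?case
    using hom_poly_mult_linear[OF Suc.IH[OF \<beta>(1)] linear_form_coord[of i]]
    by (simp only: monomial_mult_coord \<beta>(2))
qed

text \<open>A linear form is a combination of coordinates, and a coordinate times a monomial is a
  monomial of the next degree.\<close>

lemma monomial_span_mult_linear:
  assumes "f \<in> fn.span (monomial ` weak_compositions UNIV d)" "linear_form l"
  shows "(\<lambda>w. f w * l w) \<in> fn.span (monomial ` weak_compositions UNIV (Suc d))" (is "_ \<in> ?S")
  using assms(1)
proof (induction rule: fn.span_induct)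
  case base
  show ?case
    by (rule fn_fn.subspace_preimage[OF _ _ fn.subspace_span])
      (auto simp: fscale_def fun_eq_iff distrib_right)
next
  case (step f)
  then obtain \<alpha> where \<alpha>: "f = monomial \<alpha>" "\<alpha> \<in> weak_compositions UNIV d" by blast
  have "(\<lambda>w. f w * l w) = (\<Sum>i\<in>UNIV. fscale (*) (l (e i)) (monomial (\<alpha>(i := Suc (\<alpha> i)))))"
  proof
    fix w
    show "f w * l w = (\<Sum>i\<in>UNIV. fscale (*) (l (e i)) (monomial (\<alpha>(i := Suc (\<alpha> i))))) w"
      by (subst linear_form_expand[OF assms(2), of w])
        (simp add: \<alpha> sum_fun_apply fscale_def monomial_mult_coord[symmetric] sum_distrib_left mult_ac)
  qed
  also have "\<dots> \<in> ?S"
    using fun_upd_Suc_in_weak_compositions[OF \<alpha>(2)]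
    by (intro fn.span_sum fn.span_scale fn.span_base) blast
  finally show ?case .
qed

lemma hom_poly_eq_span: "hom_poly s d = fn.span (monomial ` weak_compositions UNIV d)"
proof
  show "fn.span (monomial ` weak_compositions UNIV d) \<subseteq> hom_poly s d"
    using monomial_hom_poly by (intro fn.span_minimal subspace_hom_poly) blast
  show "hom_poly s d \<subseteq> fn.span (monomial ` weak_compositions UNIV d)"
  proof
    fix f assume "f \<in> hom_poly s d"
    then show "f \<in> fn.span (monomial ` weak_compositions UNIV d)"
    proof (induction rule: hom_poly_induct)
      case one
      have "(\<lambda>_. 1) = monomial (\<lambda>_. 0)" by (simp add: monomial_def fun_eq_iff)
      then show ?case by (auto intro: fn.span_base simp: weak_compositions_0)
    qed (simp_all add: monomial_span_mult_linear)
  qed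
qed

text \<open>Every tuple of complex numbers is the coordinate tuple of a point of W, so a relation
  between monomials on W is one between monomial functions of independent variables.\<close>

lemma monomial_coeff_zero:
  assumes "finite A" "\<And>w. (\<Sum>\<alpha>\<in>A. a \<alpha> * monomial \<alpha> w) = 0" "\<beta> \<in> A"
  shows "a \<beta> = 0"
proof (rule monomial_functions_independent[OF assms(1) _ assms(3)])
  fix z :: "'n \<Rightarrow> complex"
  have "coord s e i (\<Sum>j\<in>UNIV. s (z j) (e j)) = z i" for i
    by (simp add: coord_sum coord_scale coord_basis if_distrib cong: if_cong)
  then show "(\<Sum>\<alpha>\<in>A. a \<alpha> * (\<Prod>i\<in>UNIV. z i ^ \<alpha> i)) = 0"
    using assms(2)[of "\<Sum>j\<in>UNIV. s (z j) (e j)"] by (simp add: monomial_def)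
qed

lemma inj_on_monomial: "inj_on monomial (weak_compositions UNIV d)" (is ?inj)
  and independent_monomials: "fn.independent (monomial ` weak_compositions UNIV d)" (is ?indep)
proof -
  have fin: "finite (weak_compositions (UNIV :: 'n set) d)" by (simp add: finite_weak_compositions)
  have zero: "\<forall>\<alpha>\<in>weak_compositions UNIV d. a \<alpha> = 0"
    if "(\<Sum>\<alpha>\<in>weak_compositions UNIV d. fscale (*) (a \<alpha>) (monomial \<alpha>)) = 0" for a
    using that monomial_coeff_zero[OF fin, of a]
    by (auto simp: fun_eq_iff sum_fun_apply fscale_def)
  show ?inj ?indep by (rule fn.independent_family[OF fin zero]; assumption)+
qed

section \<open>Homogeneous vector fields and monomial fields\<close>

definition monomial_field :: "('n \<Rightarrow> nat) \<times> 'n \<Rightarrow> 'w \<Rightarrow> 'w"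
  where "monomial_field = (\<lambda>(\<alpha>, i) w. s (monomial \<alpha> w) (e i))"

lemma inj_on_monomial_field: "inj_on monomial_field (weak_compositions UNIV d \<times> UNIV)" (is ?inj)
  and independent_monomial_fields:
    "fld.independent (monomial_field ` (weak_compositions UNIV d \<times> UNIV))" (is ?indep)
proof -
  have fin: "finite (weak_compositions (UNIV :: 'n set) d)" by (simp add: finite_weak_compositions)
  then have fin2: "finite (weak_compositions (UNIV :: 'n set) d \<times> (UNIV :: 'n set))" by simp
  have zero: "\<forall>p\<in>weak_compositions UNIV d \<times> UNIV. a p = 0"
    if a: "(\<Sum>p\<in>weak_compositions UNIV d \<times> UNIV. fscale s (a p) (monomial_field p)) = 0" for a
  proof clarify
    fix \<alpha> :: "'n \<Rightarrow> nat" and i :: 'n assume \<alpha>: "\<alpha> \<in> weak_compositions UNIV d"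
    \<comment> \<open>The i-th coordinate of the relation between fields is a relation between
      monomials.\<close>
    have "(\<Sum>\<alpha>\<in>weak_compositions UNIV d. a (\<alpha>, i) * monomial \<alpha> w) = 0" for w
    proof -
      have "0 = coord s e i (\<Sum>p\<in>weak_compositions UNIV d \<times> UNIV. s (a p) (monomial_field p w))"
        using fun_cong[OF a, of w] by (simp add: sum_fun_apply fscale_def coord_zero)
      also have "\<dots> = (\<Sum>\<alpha>\<in>weak_compositions UNIV d. \<Sum>j\<in>UNIV.
          a (\<alpha>, j) * (monomial \<alpha> w * (if i = j then 1 else 0)))"
        unfolding coord_sum sum.cartesian_product
        by (intro sum.cong) (auto simp: coord_scale coord_basis monomial_field_def)
      also have "\<dots> = (\<Sum>\<alpha>\<in>weak_compositions UNIV d. a (\<alpha>, i) * monomial \<alpha> w)"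
        by (simp add: if_distrib cong: if_cong)
      finally show ?thesis by simp
    qed
    then show "a (\<alpha>, i) = 0"
      by (rule monomial_coeff_zero[OF fin _ \<alpha>, of "\<lambda>\<alpha>. a (\<alpha>, i)"])
  qed
  show ?inj ?indep by (rule fld.independent_family[OF fin2 zero]; assumption)+
qed

lemma subspace_hom_field: "fld.subspace (hom_field s d)"
  unfolding hom_field_def by simp

lemma hom_field_scaleI: "f \<in> hom_poly s d \<Longrightarrow> (\<lambda>w. s (f w) u) \<in> hom_field s d"
  unfolding hom_field_def by (intro fld.span_base) blast

lemma coord_hom_field:
  assumes "v \<in> hom_field s d"
  shows "(\<lambda>w. coord s e i (v w)) \<in> hom_poly s d"
  using assms unfolding hom_field_def
proof (induction rule: fld.span_induct)
  case base
  show ?case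
    by (rule fld_fn.subspace_preimage[OF _ _ subspace_hom_poly])
      (auto simp: fscale_def fun_eq_iff coord_add coord_scale)
next
  case (step v)
  then obtain f u where "v = (\<lambda>w. s (f w) u)" "f \<in> hom_poly s d" by blast
  then show ?case
    using fn.subspace_scale[OF subspace_hom_poly, of f d "coord s e i u"]
    by (simp add: coord_scale fscale_def mult.commute)
qed

lemma field_expand: "v = (\<Sum>i\<in>UNIV. (\<lambda>w. s (coord s e i (v w)) (e i)))"
  by (simp add: fun_eq_iff sum_fun_apply sum_coord)

lemma hom_fieldI:
  assumes "\<And>i. (\<lambda>w. coord s e i (v w)) \<in> hom_poly s d"
  shows "v \<in> hom_field s d"
  by (subst field_expand)
    (intro fld.subspace_sum[OF subspace_hom_field] hom_field_scaleI assms)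

lemma hom_field_eq_span:
  "hom_field s d = fld.span (monomial_field ` (weak_compositions UNIV d \<times> UNIV))" (is "_ = ?S")
proof
  show "?S \<subseteq> hom_field s d"
    using hom_field_scaleI[OF monomial_hom_poly]
    by (intro fld.span_minimal subspace_hom_field) (auto simp: monomial_field_def)
  have 1: "(\<lambda>w. s (f w) (e i)) \<in> ?S" if "f \<in> hom_poly s d" for f i
    using that unfolding hom_poly_eq_span
  proof (induction rule: fn.span_induct)
    case base
    show ?case
      by (rule fn_fld.subspace_preimage[OF _ _ fld.subspace_span])
        (auto simp: fscale_def fun_eq_iff scale_left_distrib)
  next
    case (step f)
    then show ?case
      by (intro fld.span_base) (auto simp: monomial_field_def image_iff)
  qed
  show "hom_field s d \<subseteq> ?S"
  proof
    fix v assume v: "v \<in> hom_field s d"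
    show "v \<in> ?S"
      by (subst field_expand) (intro fld.span_sum 1 coord_hom_field[OF v])
  qed
qed

end

section \<open>Divergence\<close>

context indexed_basis begin

text \<open>W carries no topology, so only the functions of one complex variable obtained along
  lines are differentiated. \<open>L\<close> takes the place of the differential of f at w; getting
  all directions from one \<open>L\<close> yields linearity in the direction.\<close>

lemma hom_poly_has_directional_derivatives:
  assumes "f \<in> hom_poly s d"
  shows "\<exists>L. linear_form L \<and> (\<forall>u. ((\<lambda>z. f (w + s z u)) has_field_derivative L u) (at 0))"
  using assms
proof (induction rule: hom_poly_induct)
  case (subspace d)
  show ?case
  proof (rule fn.subspaceI; clarsimp)
    show "\<exists>L. linear_form L \<and> (\<forall>u. ((\<lambda>z. 0) has_field_derivative L u) (at 0))"
      by (rule exI[of _ "\<lambda>_. 0"]) (auto intro: linear_formI)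
  next
    fix f g L L'
    assume "linear_form L" "\<forall>u. ((\<lambda>z. f (w + s z u)) has_field_derivative L u) (at 0)"
      "linear_form L'" "\<forall>u. ((\<lambda>z. g (w + s z u)) has_field_derivative L' u) (at 0)"
    then show "\<exists>L. linear_form L \<and>
        (\<forall>u. ((\<lambda>z. f (w + s z u) + g (w + s z u)) has_field_derivative L u) (at 0))"
      by (intro exI[of _ "\<lambda>u. L u + L' u"] conjI allI linear_formI DERIV_add)
        (simp_all add: linear_form_add linear_form_scale distrib_left)
  next
    fix c f L
    assume "linear_form L" "\<forall>u. ((\<lambda>z. f (w + s z u)) has_field_derivative L u) (at 0)"
    then show "\<exists>L. linear_form L \<and>
        (\<forall>u. ((\<lambda>z. fscale (*) c f (w + s z u)) has_field_derivative L u) (at 0))"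
      unfolding fscale_def
      by (intro exI[of _ "\<lambda>u. c * L u"] conjI allI linear_formI DERIV_cmult)
        (simp_all add: linear_form_add linear_form_scale distrib_left)
  qed
next
  case one
  show ?case by (rule exI[of _ "\<lambda>_. 0"]) (auto intro: linear_formI)
next
  case (mult d f l)
  then obtain L where L: "linear_form L" "\<And>u. ((\<lambda>z. f (w + s z u)) has_field_derivative L u) (at 0)"
    by blast
  have "((\<lambda>z. f (w + s z u) * l (w + s z u)) has_field_derivative L u * l w + f w * l u) (at 0)" for u
  proof -
    have "((\<lambda>z. l w + z * l u) has_field_derivative l u) (at 0)"
      by (auto intro!: derivative_eq_intros)
    then have "((\<lambda>z. l (w + s z u)) has_field_derivative l u) (at 0)"
      by (simp add: linear_form_add[OF mult.hyps(2)] linear_form_scale[OF mult.hyps(2)])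
    from DERIV_mult[OF L(2)[of u] this] show ?thesis
      by (simp add: mult.commute)
  qed
  moreover have "linear_form (\<lambda>u. L u * l w + f w * l u)"
    by (rule linear_formI)
      (simp_all add: linear_form_add[OF mult.hyps(2)] linear_form_scale[OF mult.hyps(2)]
        linear_form_add[OF L(1)] linear_form_scale[OF L(1)] algebra_simps)
  ultimately show ?case by blast
qed

definition dirderiv :: "('w \<Rightarrow> complex) \<Rightarrow> 'w \<Rightarrow> 'w \<Rightarrow> complex"
  where "dirderiv f u w = deriv (\<lambda>z. f (w + s z u)) 0"

lemma dirderiv_has_derivative:
  "f \<in> hom_poly s d \<Longrightarrow> ((\<lambda>z. f (w + s z u)) has_field_derivative dirderiv f u w) (at 0)"
  unfolding dirderiv_def
  using hom_poly_has_directional_derivatives[of f d w] DERIV_imp_deriv by metis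

lemma linear_form_dirderiv:
  assumes "f \<in> hom_poly s d"
  shows "linear_form (\<lambda>u. dirderiv f u w)"
proof -
  obtain L where "linear_form L" "\<And>u. ((\<lambda>z. f (w + s z u)) has_field_derivative L u) (at 0)"
    using hom_poly_has_directional_derivatives[OF assms] by blast
  moreover from this have "(\<lambda>u. dirderiv f u w) = L"
    unfolding dirderiv_def by (auto intro: DERIV_imp_deriv)
  ultimately show ?thesis by simp
qed

lemma dirderiv_add:
  assumes "f \<in> hom_poly s d" "g \<in> hom_poly s d"
  shows "dirderiv (\<lambda>w. f w + g w) u w = dirderiv f u w + dirderiv g u w"
  using DERIV_add[OF assms[THEN dirderiv_has_derivative]]
  by (subst dirderiv_def) (rule DERIV_imp_deriv)

lemma dirderiv_cmult:
  assumes "f \<in> hom_poly s d"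
  shows "dirderiv (\<lambda>w. c * f w) u w = c * dirderiv f u w"
  using DERIV_cmult[OF assms[THEN dirderiv_has_derivative]]
  by (subst dirderiv_def) (rule DERIV_imp_deriv)

lemma dirderiv_const: "dirderiv (\<lambda>_. c) u w = 0"
  by (simp add: dirderiv_def)

lemma dirderiv_linear_form:
  assumes "linear_form l"
  shows "dirderiv l u w = l u"
  unfolding dirderiv_def linear_form_add[OF assms] linear_form_scale[OF assms]
  by (rule DERIV_imp_deriv) (auto intro!: derivative_eq_intros)

lemma linear_form_hom_poly:
  assumes "linear_form l"
  shows "l \<in> hom_poly s (Suc 0)"
  using hom_poly_mult_linear[OF one_hom_poly assms] by simp

lemma dirderiv_mult_linear:
  assumes "f \<in> hom_poly s d" "linear_form l"
  shows "dirderiv (\<lambda>w. f w * l w) u w = dirderiv f u w * l w + f w * l u"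
  using DERIV_mult[OF dirderiv_has_derivative[OF assms(1), of w u]
    dirderiv_has_derivative[OF linear_form_hom_poly[OF assms(2)], of w u]]
  by (subst dirderiv_def, intro DERIV_imp_deriv)
    (simp add: dirderiv_linear_form[OF assms(2)] mult.commute)

lemma dirderiv_hom_poly:
  assumes "f \<in> hom_poly s (Suc d)"
  shows "dirderiv f u \<in> hom_poly s d"
proof -
  \<comment> \<open>The induction runs through all degrees, so degree 0 gets a value as well: the
    derivative vanishes there. Membership of f is included because sums can be differentiated
    termwise only for polynomials.\<close>
  have "f \<in> hom_poly s d \<and> (case d of 0 \<Rightarrow> dirderiv f u = 0 | Suc d' \<Rightarrow> dirderiv f u \<in> hom_poly s d')"
    if "f \<in> hom_poly s d" for f d
    using that
  proof (induction rule: hom_poly_induct)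
    case (subspace d)
    let ?V = "case d of 0 \<Rightarrow> {0} | Suc d' \<Rightarrow> hom_poly s d'"
    note S = subspace_hom_poly[of d]
    have V: "fn.subspace ?V"
      by (cases d) (simp_all add: subspace_hom_poly)
    have eq: "{f. f \<in> hom_poly s d \<and> (case d of 0 \<Rightarrow> dirderiv f u = 0 | Suc d' \<Rightarrow> dirderiv f u \<in> hom_poly s d')}
        = {f. f \<in> hom_poly s d \<and> dirderiv f u \<in> ?V}"
      by (cases d) simp_all
    have add: "dirderiv (f + g) u = dirderiv f u + dirderiv g u"
      if "f \<in> hom_poly s d" "g \<in> hom_poly s d" for f g
      using dirderiv_add[OF that] by (simp add: fun_eq_iff plus_fun_def)
    have scale: "dirderiv (fscale (*) c f) u = fscale (*) c (dirderiv f u)"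
      if "f \<in> hom_poly s d" for c f
      using dirderiv_cmult[OF that] by (simp add: fun_eq_iff fscale_def)
    have zero: "dirderiv 0 u = 0"
      using dirderiv_const[of 0 u] by (simp add: fun_eq_iff zero_fun_def)
    show ?case
      unfolding eq using S V
      by (intro fn.subspaceI)
        (auto simp: add scale zero fn.subspace_0 fn.subspace_add fn.subspace_scale)
  next
    case one
    show ?case using one_hom_poly dirderiv_const by (simp add: fun_eq_iff)
  next
    case (mult d f l)
    have "dirderiv (\<lambda>w. f w * l w) u = (\<lambda>w. dirderiv f u w * l w) + fscale (*) (l u) f"
      using dirderiv_mult_linear[OF mult.hyps] by (simp add: fun_eq_iff fscale_def mult.commute)
    moreover have "(\<lambda>w. dirderiv f u w * l w) \<in> hom_poly s d"
      using mult hom_poly_mult_linear[of "dirderiv f u" _ l] fn.subspace_0[OF subspace_hom_poly]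
      by (cases d) (simp_all add: zero_fun_def)
    ultimately show ?case
      using mult.hyps(1) hom_poly_mult_linear[OF mult.hyps]
      by (simp add: fn.subspace_add fn.subspace_scale subspace_hom_poly)
  qed
  from this[OF assms] show ?thesis by simp
qed

lemma dirderiv_hom_poly_0:
  assumes "f \<in> hom_poly s 0"
  shows "dirderiv f u w = 0"
proof -
  have "f \<in> fn.span {\<lambda>_. 1}"
    using assms by (simp add: hom_poly_def)
  then obtain k where "f = fscale (*) k (\<lambda>_. 1)"
    by (auto simp: fn.span_singleton)
  then show ?thesis by (simp add: fscale_def dirderiv_const)
qed

text \<open>In the direction w each linear factor l has derivative l(w) at w, so the product rule
  counts the factors.\<close>

lemma euler_identity:
  assumes "f \<in> hom_poly s d"
  shows "dirderiv f w w = of_nat d * f w"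
proof -
  have "f \<in> hom_poly s d \<and> (\<forall>w. dirderiv f w w = of_nat d * f w)"
    using assms
  proof (induction rule: hom_poly_induct)
    case (subspace d)
    note S = subspace_hom_poly[of d]
    show ?case
      using fn.subspace_0[OF S] fn.subspace_add[OF S] fn.subspace_scale[OF S]
        dirderiv_add[of _ d] dirderiv_cmult[of _ d]
      by (intro fn.subspaceI)
        (auto simp: zero_fun_def plus_fun_def fscale_def dirderiv_const distrib_left)
  qed (auto simp: one_hom_poly dirderiv_const hom_poly_mult_linear dirderiv_mult_linear algebra_simps)
  then show ?thesis by simp
qed

section \<open>The divergence and multiples of the Euler field\<close>

lemma divergence_eq_sum_dirderiv:
  "divergence s e v w = (\<Sum>i\<in>UNIV. dirderiv (\<lambda>w. coord s e i (v w)) (e i) w)"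
  by (simp add: divergence_def dirderiv_def)

lemma divergence_add:
  assumes "u \<in> hom_field s d" "v \<in> hom_field s d"
  shows "divergence s e (u + v) = divergence s e u + divergence s e v"
  using dirderiv_add[OF assms[THEN coord_hom_field]]
  by (simp add: divergence_eq_sum_dirderiv coord_add fun_eq_iff sum.distrib)

lemma divergence_scale:
  assumes "v \<in> hom_field s d"
  shows "divergence s e (fscale s c v) = fscale (*) c (divergence s e v)"
  using dirderiv_cmult[OF assms[THEN coord_hom_field]]
  by (simp add: divergence_eq_sum_dirderiv coord_scale fun_eq_iff sum_distrib_left fscale_def)

lemma divergence_zero: "divergence s e 0 = 0"
  using dirderiv_const by (simp add: divergence_eq_sum_dirderiv coord_zero fun_eq_iff)

lemma divergence_hom_poly:
  assumes "v \<in> hom_field s (Suc d)"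
  shows "divergence s e v \<in> hom_poly s d"
proof -
  have "divergence s e v = (\<Sum>i\<in>UNIV. dirderiv (\<lambda>w. coord s e i (v w)) (e i))"
    by (simp add: divergence_eq_sum_dirderiv fun_eq_iff sum_fun_apply)
  then show ?thesis
    using dirderiv_hom_poly[OF coord_hom_field[OF assms]]
    by (simp add: fn.subspace_sum[OF subspace_hom_poly])
qed

text \<open>A form free of coordinates: u need not be a basis vector, so the formula also covers the
  moved vector \<open>\<phi> u\<close> when fields are pushed forward.\<close>

lemma divergence_scaleI:
  assumes "f \<in> hom_poly s d"
  shows "divergence s e (\<lambda>w. s (f w) u) w = dirderiv f u w"
proof -
  have "dirderiv (\<lambda>w. coord s e i (s (f w) u)) (e i) w = dirderiv f (e i) w * coord s e i u" for i
    using dirderiv_cmult[OF assms, of "coord s e i u"] by (simp add: coord_scale mult.commute)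
  then show ?thesis
    by (simp add: divergence_eq_sum_dirderiv
        linear_form_expand[OF linear_form_dirderiv[OF assms], of u])
qed

definition euler :: "('w \<Rightarrow> complex) \<Rightarrow> 'w \<Rightarrow> 'w"
  where "euler f w = s (f w) w"

lemma euler_hom_field:
  assumes "f \<in> hom_poly s d"
  shows "euler f \<in> hom_field s (Suc d)"
  by (rule hom_fieldI) (simp add: euler_def coord_scale hom_poly_mult_linear assms linear_form_coord)

text \<open>The product rule in coordinates gives two contributions: the sum of x_i times the i-th
  partial derivative of f, which is d f by Euler's identity, and f once for each coordinate.\<close>

lemma divergence_euler:
  assumes "f \<in> hom_poly s d"
  shows "divergence s e (euler f) = fscale (*) (of_nat (d + CARD('n))) f"
proof
  fix w
  have "divergence s e (euler f) w =
      (\<Sum>i\<in>UNIV. dirderiv f (e i) w * coord s e i w) + of_nat CARD('n) * f w"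
    by (simp add: divergence_eq_sum_dirderiv euler_def coord_scale coord_basis sum.distrib
        dirderiv_mult_linear[OF assms linear_form_coord])
  also have "(\<Sum>i\<in>UNIV. dirderiv f (e i) w * coord s e i w) = of_nat d * f w"
    by (simp add: linear_form_expand[OF linear_form_dirderiv[OF assms], symmetric]
        euler_identity[OF assms])
  finally show "divergence s e (euler f) w = fscale (*) (of_nat (d + CARD('n))) f w"
    by (simp add: fscale_def distrib_right)
qed

section \<open>Compatibility with linear automorphisms\<close>

lemma hom_poly_compose:
  assumes "f \<in> hom_poly s d" "Vector_Spaces.linear s s \<phi>"
  shows "f \<circ> \<phi> \<in> hom_poly s d"
  using assms(1)
proof (induction rule: hom_poly_induct)
  case (subspace d)
  show ?case
    by (rule fn_fn.subspace_preimage[OF _ _ subspace_hom_poly]) (auto simp: fscale_def fun_eq_iff)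
next
  case one
  show ?case using one_hom_poly by (simp add: o_def)
next
  case (mult d f l)
  have "linear_form (l \<circ> \<phi>)"
    using assms(2) mult.hyps(2) by (rule Vector_Spaces.linear_compose)
  from hom_poly_mult_linear[OF mult.IH this] show ?case by (simp add: o_def)
qed

lemma pushforward_add:
  assumes "Vector_Spaces.linear s s \<phi>"
  shows "pushforward \<phi> (u + v) = pushforward \<phi> u + pushforward \<phi> v"
  using assms unfolding Vector_Spaces.linear_iff by (simp add: pushforward_def fun_eq_iff)

lemma pushforward_scale:
  assumes "Vector_Spaces.linear s s \<phi>"
  shows "pushforward \<phi> (fscale s c v) = fscale s c (pushforward \<phi> v)"
  using assms unfolding Vector_Spaces.linear_iff by (simp add: pushforward_def fscale_def fun_eq_iff)

lemma pushforward_simple: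
  assumes "Vector_Spaces.linear s s \<phi>"
  shows "pushforward \<phi> (\<lambda>w. s (f w) u) = (\<lambda>w. s ((f \<circ> inv_into UNIV \<phi>) w) (\<phi> u))"
  using assms unfolding Vector_Spaces.linear_iff by (simp add: pushforward_def fun_eq_iff)

text \<open>Linear automorphisms fix the Euler field, so only the coefficient f is
  transported.\<close>

lemma pushforward_euler:
  assumes "Vector_Spaces.linear s s \<phi>" "bij \<phi>"
  shows "pushforward \<phi> (euler f) = euler (f \<circ> inv_into UNIV \<phi>)"
  using assms unfolding Vector_Spaces.linear_iff
  by (simp add: pushforward_def euler_def fun_eq_iff bij_is_surj surj_f_inv_f)

lemma pushforward_hom_field:
  assumes "v \<in> hom_field s d" "Vector_Spaces.linear s s \<phi>" "bij \<phi>"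
  shows "pushforward \<phi> v \<in> hom_field s d"
  using assms(1) unfolding hom_field_def[of s d]
proof (induction rule: fld.span_induct)
  case base
  interpret fld_fld: vector_space_pair "fscale s :: complex \<Rightarrow> ('w \<Rightarrow> 'w) \<Rightarrow> 'w \<Rightarrow> 'w"
    "fscale s :: complex \<Rightarrow> ('w \<Rightarrow> 'w) \<Rightarrow> 'w \<Rightarrow> 'w" ..
  show ?case
    by (rule fld_fld.subspace_preimage[OF pushforward_add[OF assms(2)]
          pushforward_scale[OF assms(2)] fld.subspace_span])
next
  case (step v)
  then obtain f u where "v = (\<lambda>w. s (f w) u)" "f \<in> hom_poly s d" by blast
  then have "pushforward \<phi> v \<in> hom_field s d"
    using assms(2,3) by (auto simp only: pushforward_simple intro!: hom_field_scaleI hom_poly_compose linear_inv)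
  then show ?case by (simp add: hom_field_def)
qed

lemma divergence_pushforward:
  assumes "v \<in> hom_field s d" "Vector_Spaces.linear s s \<phi>" "bij \<phi>"
  shows "divergence s e (pushforward \<phi> v) = divergence s e v \<circ> inv_into UNIV \<phi>"
proof -
  \<comment> \<open>Membership is carried along since additivity of the divergence is available only
    for homogeneous fields.\<close>
  have "v \<in> hom_field s d \<and> divergence s e (pushforward \<phi> v) = divergence s e v \<circ> inv_into UNIV \<phi>"
    using assms(1) unfolding hom_field_def[of s d]
  proof (induction rule: fld.span_induct)
    case base
    note S = subspace_hom_field[of d]
    have zero: "pushforward \<phi> 0 = 0"
      using pushforward_scale[OF assms(2), of 0 0] by (simp add: fscale_def zero_fun_def)
    show ?case
      using fld.subspace_0[OF S] fld.subspace_add[OF S] fld.subspace_scale[OF S]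
      unfolding hom_field_def[symmetric]
      by (intro fld.subspaceI)
        (auto simp: zero divergence_zero divergence_add[of _ d] divergence_scale[of _ d]
          pushforward_add pushforward_scale pushforward_hom_field assms(2,3) fun_eq_iff fscale_apply)
  next
    case (step v)
    then obtain f u where v: "v = (\<lambda>w. s (f w) u)" "f \<in> hom_poly s d" by blast
    note lin = linear_inv[OF assms(2,3)]
    \<comment> \<open>The inverse of \<phi> sends the line through w in direction
      \<open>\<phi> u\<close> to the line through the preimage of w in direction u, with the same
      parameter.\<close>
    have "dirderiv (f \<circ> inv_into UNIV \<phi>) (\<phi> u) w = dirderiv f u (inv_into UNIV \<phi> w)" for w
      using lin assms(3) unfolding Vector_Spaces.linear_iff dirderiv_def
      by (simp add: bij_is_inj)
    then have "divergence s e (pushforward \<phi> v) = divergence s e v \<circ> inv_into UNIV \<phi>"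
      unfolding v pushforward_simple[OF assms(2)]
      by (simp add: fun_eq_iff divergence_scaleI[OF hom_poly_compose[OF v(2) lin]]
          divergence_scaleI[OF v(2)] del: o_apply) (simp add: divergence_scaleI[OF v(2)])
    moreover have "v \<in> hom_field s d" using v hom_field_scaleI by blast
    ultimately show ?case by (simp add: hom_field_def)
  qed
  then show ?thesis by simp
qed

end

section \<open>Traces of a diagonalizable map\<close>

context indexed_basis begin

text \<open>A discrete Fourier transform over the powers of \<phi> writes each vector as a sum of
  eigenvectors; a basis is then chosen among the eigenvectors.\<close>

lemma ex_eigenbasis:
  assumes lin: "Vector_Spaces.linear s s \<phi>" and m: "m > 0" "\<phi> ^^ m = id"
  shows "\<exists>(b :: 'n \<Rightarrow> 'w) a. indexed_basis s b \<and> (\<forall>i. \<phi> (b i) = s (a i) (b i))"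
proof -
  interpret \<phi>: Vector_Spaces.linear s s \<phi> by fact
  obtain \<omega> :: complex where \<omega>: "\<And>j. \<omega> ^ j = 1 \<longleftrightarrow> m dvd j"
    using ex_primitive_root_of_unity[OF m(1)] by blast
  then have "\<omega> \<noteq> 0" using m by (metis dvd_refl power_0_left zero_neq_one less_irrefl)
  define E where "E = {v. \<exists>a. \<phi> v = s a v}"
  define p where "p j w = (\<Sum>k<m. s (\<omega> ^ (k * j)) ((\<phi> ^^ k) w))" for j w
  have p: "p j w \<in> E" for j w
  proof -
    let ?g = "\<lambda>k. s (\<omega> ^ (k * j)) ((\<phi> ^^ k) w)"
    \<comment> \<open>The summands have period m in k, so applying \<phi> only shifts the sum
      cyclically and costs the factor \<open>\<omega> ^ j\<close>.\<close>
    have "?g m = ?g 0"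
      using \<omega>[of "m * j"] m by simp
    then have shift: "(\<Sum>k<m. ?g (Suc k)) = (\<Sum>k<m. ?g k)"
      using sum.lessThan_Suc_shift[of ?g m] sum.lessThan_Suc[of ?g m] by simp
    have "s (\<omega> ^ j) (\<phi> (p j w)) = (\<Sum>k<m. ?g (Suc k))"
      by (simp add: p_def \<phi>.sum \<phi>.scale scale_sum_right power_add)
    then have "s (\<omega> ^ j) (\<phi> (p j w)) = p j w"
      by (simp only: shift p_def)
    from arg_cong[OF this, of "s (inverse (\<omega> ^ j))"]
    have "\<phi> (p j w) = s (inverse (\<omega> ^ j)) (p j w)"
      using \<open>\<omega> \<noteq> 0\<close> by simp
    then show ?thesis by (auto simp: E_def)
  qed
  have sum_p: "(\<Sum>j<m. p j w) = s (of_nat m) w" for w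
  proof -
    \<comment> \<open>Summing over j first, orthogonality of roots of unity kills every power of
      \<phi> except k = 0.\<close>
    have "(\<Sum>j<m. p j w) = (\<Sum>k<m. \<Sum>j<m. s (\<omega> ^ (j * k)) ((\<phi> ^^ k) w))"
      unfolding p_def by (subst sum.swap) (simp add: mult.commute)
    also have "\<dots> = (\<Sum>k<m. s (\<Sum>j<m. \<omega> ^ (j * k)) ((\<phi> ^^ k) w))"
      by (simp add: scale_sum_left)
    also have "\<dots> = (\<Sum>k<m. if k = 0 then s (of_nat m) w else 0)"
      by (rule sum.cong) (auto simp: sum_powers_root_of_unity[OF \<omega>] dest: dvd_imp_le)
    also have "\<dots> = s (of_nat m) w" using m by simp
    finally show ?thesis .
  qed
  have span_E: "w \<in> span E" for w
  proof -
    have "w = s (inverse (of_nat m)) (\<Sum>j<m. p j w)"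
      using m by (simp add: sum_p)
    also have "\<dots> \<in> span E"
      by (intro span_scale span_sum span_base p)
    finally show ?thesis .
  qed
  obtain B where B: "B \<subseteq> E" "independent B" "E \<subseteq> span B"
    using maximal_independent_subset .
  have "span B = UNIV"
    using span_minimal[OF B(3) subspace_span] span_E by blast
  \<comment> \<open>The eigenbasis takes over the index type of \<open>e\<close>, so that weak
    compositions and matrices for both bases have the same type.\<close>
  then obtain h where h: "bij_betw h (range e) B"
    using bij_if_span_eq_span_bases[OF independent_Basis B(2)] span_Basis by metis
  define b where "b = h \<circ> e"
  have b: "range b = B" "inj b"
    using h comp_inj_on[OF inj_e, of h] by (auto simp: b_def bij_betw_def)
  have "indexed_basis s b"
  proof
    show "finite (range b)" by simp
  qed (simp_all only: b B(2) \<open>span B = UNIV\<close> not_False_eq_True)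
  moreover have "\<exists>a. \<phi> (b i) = s a (b i)" for i
    using B(1) b(1) by (auto simp: E_def)
  then obtain a where "\<And>i. \<phi> (b i) = s (a i) (b i)"
    by metis
  ultimately show ?thesis by blast
qed

lemma basis_nonzero: "e i \<noteq> 0"
  using dependent_zero[of "range e"] independent_Basis by (metis rangeI)

lemma inv_eigenvector:
  assumes "Vector_Spaces.linear s s \<phi>" "bij \<phi>" "\<phi> (e i) = s a (e i)"
  shows "a \<noteq> 0" and "inv_into UNIV \<phi> (e i) = s (inverse a) (e i)"
proof -
  interpret \<phi>: Vector_Spaces.linear s s \<phi> by fact
  have "\<phi> (e i) \<noteq> \<phi> 0"
    by (simp only: inj_eq[OF bij_is_inj[OF assms(2)]] basis_nonzero not_False_eq_True)
  then show a: "a \<noteq> 0" using assms(3) by auto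
  show "inv_into UNIV \<phi> (e i) = s (inverse a) (e i)"
    using a by (intro inv_f_eq bij_is_inj assms) (simp add: \<phi>.scale assms(3))
qed

lemma coord_eigenvector:
  assumes lin: "Vector_Spaces.linear s s \<phi>" and eig: "\<And>i. \<phi> (e i) = s (a i) (e i)"
  shows "coord s e i (\<phi> w) = a i * coord s e i w"
proof -
  have "linear_form (coord s e i \<circ> \<phi>)"
    using lin linear_form_coord by (rule Vector_Spaces.linear_compose)
  from linear_form_expand[OF this, of w] show ?thesis
    by (simp add: eig coord_scale coord_basis if_distrib if_distribR cong: if_cong)
qed

lemma trace_pullback_eigenbasis:
  assumes lin: "Vector_Spaces.linear s s \<phi>" and eig: "\<And>i. \<phi> (e i) = s (a i) (e i)"
  shows "fn.trace_wrt (monomial ` weak_compositions UNIV d) (\<lambda>f. f \<circ> \<phi>) =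
    (\<Sum>\<alpha>\<in>weak_compositions UNIV d. \<Prod>i\<in>UNIV. a i ^ \<alpha> i)"
proof -
  have "monomial \<alpha> \<circ> \<phi> = fscale (*) (\<Prod>i\<in>UNIV. a i ^ \<alpha> i) (monomial \<alpha>)" for \<alpha>
    by (simp add: fun_eq_iff fscale_apply monomial_def coord_eigenvector[OF assms] power_mult_distrib
        prod.distrib)
  then show ?thesis
    by (intro fn.trace_wrt_eigenbasis inj_on_monomial independent_monomials)
qed

lemma trace_pushforward_inv_eigenbasis:
  assumes lin: "Vector_Spaces.linear s s \<phi>" "bij \<phi>" and eig: "\<And>i. \<phi> (e i) = s (a i) (e i)"
  shows "fld.trace_wrt (monomial_field ` (weak_compositions UNIV d \<times> UNIV))
      (pushforward (inv_into UNIV \<phi>)) =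
    (\<Sum>i\<in>UNIV. inverse (a i)) * (\<Sum>\<alpha>\<in>weak_compositions UNIV d. \<Prod>i\<in>UNIV. a i ^ \<alpha> i)"
proof -
  have "pushforward (inv_into UNIV \<phi>) (monomial_field p) =
      fscale s ((\<Prod>i\<in>UNIV. a i ^ fst p i) * inverse (a (snd p))) (monomial_field p)" for p
  proof -
    \<comment> \<open>Pushing forward by the inverse composes the coefficient with \<phi> but
      applies the inverse to the vector; hence powers of the \<open>a i\<close> come with one
      reciprocal.\<close>
    have "pushforward (inv_into UNIV \<phi>) (monomial_field p)
        = (\<lambda>w. s (monomial (fst p) (\<phi> w)) (inv_into UNIV \<phi> (e (snd p))))"
      by (simp add: monomial_field_def split_def pushforward_simple[OF linear_inv[OF lin]]
          inv_inv_eq[OF lin(2)])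
    then show ?thesis
      by (simp add: inv_eigenvector[OF lin eig] fun_eq_iff fscale_apply monomial_field_def split_def
          monomial_def coord_eigenvector[OF lin(1) eig] power_mult_distrib prod.distrib mult_ac)
  qed
  then have "fld.trace_wrt (monomial_field ` (weak_compositions UNIV d \<times> UNIV))
      (pushforward (inv_into UNIV \<phi>)) =
      (\<Sum>p\<in>weak_compositions UNIV d \<times> UNIV. (\<Prod>i\<in>UNIV. a i ^ fst p i) * inverse (a (snd p)))"
    by (intro fld.trace_wrt_eigenbasis inj_on_monomial_field independent_monomial_fields)
  also have "\<dots> = (\<Sum>i\<in>UNIV. inverse (a i)) * (\<Sum>\<alpha>\<in>weak_compositions UNIV d. \<Prod>i\<in>UNIV. a i ^ \<alpha> i)"
    by (subst mult.commute) (simp only: sum_product sum.cartesian_product split_def)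
  finally show ?thesis .
qed

section \<open>Trace and determinant by conjugation to diagonal form\<close>

lemma sum_coord_change_basis:
  assumes "indexed_basis s b"
  shows "(\<Sum>k\<in>UNIV. coord s e i (b k) * coord s b k w) = coord s e i w"
  using indexed_basis.linear_form_expand[OF assms linear_form_coord, of i w] by simp

text \<open>The entries of P D Q, where D is diagonal with entries \<open>a k\<close>, and P and Q
  convert between the coordinates of \<open>b\<close> and \<open>e\<close>.\<close>

lemma coord_eigenbasis:
  assumes "indexed_basis s b" "Vector_Spaces.linear s s \<phi>" "\<And>i. \<phi> (b i) = s (a i) (b i)"
  shows "coord s e i (\<phi> w) = (\<Sum>k\<in>UNIV. a k * coord s e i (b k) * coord s b k w)"
proof -
  have "linear_form (coord s e i \<circ> \<phi>)"
    using assms(2) linear_form_coord by (rule Vector_Spaces.linear_compose)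
  from indexed_basis.linear_form_expand[OF assms(1) this, of w] show ?thesis
    by (simp add: assms(3) coord_scale)
qed

lemma trace_matrix_of_eigenbasis:
  assumes b: "indexed_basis s b" and lin: "Vector_Spaces.linear s s \<phi>"
    and eig: "\<And>i. \<phi> (b i) = s (a i) (b i)"
  shows "trace (matrix_of s e \<phi>) = (\<Sum>i\<in>UNIV. a i)"
proof -
  have "trace (matrix_of s e \<phi>) =
      (\<Sum>k\<in>UNIV. \<Sum>i\<in>UNIV. a k * coord s e i (b k) * coord s b k (e i))"
    unfolding trace_def matrix_of_def
    by (simp add: coord_eigenbasis[OF assms]) (rule sum.swap)
  also have "\<dots> = (\<Sum>k\<in>UNIV. a k * coord s b k (b k))"
  proof (rule sum.cong)
    fix k
    \<comment> \<open>With the summations exchanged, the two conversion matrices meet in the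
      opposite order; this is a diagonal entry of their product.\<close>
    have "coord s b k (b k) = (\<Sum>i\<in>UNIV. coord s b k (e i) * coord s e i (b k))"
      using indexed_basis.sum_coord_change_basis[OF b indexed_basis_axioms, of k "b k"] by simp
    then show "(\<Sum>i\<in>UNIV. a k * coord s e i (b k) * coord s b k (e i)) = a k * coord s b k (b k)"
      by (simp add: sum_distrib_left mult_ac)
  qed simp
  finally show ?thesis
    by (simp add: indexed_basis.coord_basis[OF b])
qed

text \<open>The conjugation is carried out over the ring of power series: \<open>?P\<close> and
  \<open>?Q\<close> are constant and mutually inverse, and they turn \<open>?D\<close> into I -
  tA.\<close>

lemma det_one_minus_eigenbasis:
  fixes b :: "'n \<Rightarrow> 'w"
  assumes b: "indexed_basis s b" and lin: "Vector_Spaces.linear s s \<phi>"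
    and eig: "\<And>i. \<phi> (b i) = s (a i) (b i)"
  shows "det_one_minus (matrix_of s e \<phi>) = (\<Prod>i\<in>UNIV. 1 - fps_X * fps_const (a i))"
proof -
  let ?P = "\<chi> i j. fps_const (coord s e i (b j)) :: complex fps ^ 'n ^ 'n"
  let ?Q = "\<chi> i j. fps_const (coord s b i (e j)) :: complex fps ^ 'n ^ 'n"
  let ?D = "\<chi> i j. if i = j then 1 - fps_X * fps_const (a i) else 0 :: complex fps ^ 'n ^ 'n"
  have const_sum: "(\<Sum>k\<in>UNIV. fps_const (f k)) = fps_const (\<Sum>k\<in>UNIV. f k)" for f :: "'n \<Rightarrow> complex"
    by (rule fps_ext) (simp add: fps_sum_nth)
  have PQ: "?P ** ?Q = mat 1"
    by (simp add: matrix_matrix_mult_def mat_def vec_eq_iff sum_coord_change_basis[OF b]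
        const_sum coord_basis)
  have "(?P ** ?D ** ?Q) $ i $ j = mat 1 $ i $ j - fps_X * fps_const (matrix_of s e \<phi> $ i $ j)" for i j
  proof -
    have "(?P ** ?D ** ?Q) $ i $ j = (\<Sum>k\<in>UNIV. fps_const (coord s e i (b k)) *
        (1 - fps_X * fps_const (a k)) * fps_const (coord s b k (e j)))"
      by (simp add: matrix_matrix_mult_def if_distrib cong: if_cong)
    also have "\<dots> = (\<Sum>k\<in>UNIV. fps_const (coord s e i (b k) * coord s b k (e j)) -
        fps_X * fps_const (a k * coord s e i (b k) * coord s b k (e j)))"
      by (simp add: algebra_simps flip: fps_const_mult)
    also have "\<dots> = fps_const (coord s e i (e j)) - fps_X * fps_const (coord s e i (\<phi> (e j)))"
      by (simp add: sum_subtractf sum_distrib_left[symmetric] const_sum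
          sum_coord_change_basis[OF b] coord_eigenbasis[OF assms])
    finally show ?thesis
      by (simp add: mat_def matrix_of_def coord_basis)
  qed
  then have "det_one_minus (matrix_of s e \<phi>) = det (?P ** ?D ** ?Q)"
    unfolding det_one_minus_def by (intro arg_cong[of _ _ det]) (simp add: vec_eq_iff)
  also have "\<dots> = det (?P ** ?Q) * det ?D"
    by (simp add: det_mul mult_ac)
  also have "det ?D = (\<Prod>i\<in>UNIV. 1 - fps_X * fps_const (a i))"
    by (subst det_diagonal) simp_all
  finally show ?thesis by (simp add: PQ)
qed

text \<open>As 1 / det(I - t phi) is the series of the h_d, the coefficient is tr(phi^-1) h_d -
  h_(d-1), and both terms are traces. The case split sets h_(-1) = 0.\<close>

lemma molien_summand_nth:
  assumes lin: "Vector_Spaces.linear s s \<phi>" "bij \<phi>" and m: "m > 0" "\<phi> ^^ m = id"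
  shows "fps_nth ((fps_const (trace (matrix_of s e (inv_into UNIV \<phi>))) - fps_X) /
      det_one_minus (matrix_of s e \<phi>)) d =
    fld.trace_wrt (monomial_field ` (weak_compositions UNIV d \<times> UNIV)) (pushforward (inv_into UNIV \<phi>)) -
    (case d of 0 \<Rightarrow> 0 | Suc d' \<Rightarrow> fn.trace_wrt (monomial ` weak_compositions UNIV d') (\<lambda>f. f \<circ> \<phi>))"
proof -
  obtain b :: "'n \<Rightarrow> 'w" and a where b: "indexed_basis s b" and eig: "\<And>i. \<phi> (b i) = s (a i) (b i)"
    using ex_eigenbasis[OF lin(1) m] by blast
  interpret b: indexed_basis s b by (rule b)
  define h where "h d = (\<Sum>\<alpha>\<in>weak_compositions (UNIV :: 'n set) d. \<Prod>i\<in>UNIV. a i ^ \<alpha> i)" for d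
  define t where "t = (\<Sum>i\<in>UNIV. inverse (a i))"
  have fin: "finite (weak_compositions (UNIV :: 'n set) d)" for d
    by (simp add: finite_weak_compositions)
  \<comment> \<open>Monomials in \<open>e\<close> and in the eigenbasis span the same space
    \<open>hom_poly s d\<close>, so the trace can be computed in the latter.\<close>
  have 1: "fn.trace_wrt (monomial ` weak_compositions UNIV d) (\<lambda>f. f \<circ> \<phi>) = h d" for d
    unfolding h_def b.trace_pullback_eigenbasis[OF lin(1) eig, symmetric]
    using hom_poly_compose[OF _ lin(1), of _ d]
    by (intro fn.trace_wrt_basis_change)
      (auto simp: fin independent_monomials b.independent_monomials
        hom_poly_eq_span[symmetric] b.hom_poly_eq_span[symmetric] fscale_def)
  have 2: "fld.trace_wrt (monomial_field ` (weak_compositions UNIV d \<times> UNIV))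
      (pushforward (inv_into UNIV \<phi>)) = t * h d" for d
    unfolding h_def t_def b.trace_pushforward_inv_eigenbasis[OF lin eig, symmetric]
    by (intro fld.trace_wrt_basis_change)
      (simp_all add: fin independent_monomial_fields b.independent_monomial_fields
        hom_field_eq_span[symmetric] b.hom_field_eq_span[symmetric] pushforward_hom_field
        pushforward_add pushforward_scale linear_inv[OF lin] bij_imp_bij_inv[OF lin(2)])
  have 3: "trace (matrix_of s e (inv_into UNIV \<phi>)) = t"
    unfolding t_def
    by (rule trace_matrix_of_eigenbasis[OF b linear_inv[OF lin]])
      (rule b.inv_eigenvector[OF lin eig])
  have "det_one_minus (matrix_of s e \<phi>) * Abs_fps h = 1"
    using complete_homogeneous_generating_function[of "UNIV :: 'n set" a]
    by (simp add: det_one_minus_eigenbasis[OF b lin(1) eig] h_def[abs_def])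
  \<comment> \<open>A product equal to 1 also forces a nonzero constant coefficient, so the division
    is multiplication by the inverse.\<close>
  then have "inverse (det_one_minus (matrix_of s e \<phi>)) = Abs_fps h"
    and "fps_nth (det_one_minus (matrix_of s e \<phi>)) 0 \<noteq> 0"
    by (auto intro: fps_inverse_unique dest: arg_cong[where f = "\<lambda>f. fps_nth f 0"])
  then have "(fps_const t - fps_X) / det_one_minus (matrix_of s e \<phi>) =
      (fps_const t - fps_X) * Abs_fps h"
    by (simp add: fps_divide_unit)
  then show ?thesis
    by (cases d) (simp_all add: 1 2 3 left_diff_distrib)
qed

end

section \<open>Semi-invariants of a finite group\<close>

lemma group_GL:
  assumes "vector_space s"
  shows "group (GL s)"
proof (rule groupI)
  fix \<phi> assume "\<phi> \<in> carrier (GL s)"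
  then have \<phi>: "Vector_Spaces.linear s s \<phi>" "bij \<phi>" by (simp_all add: GL_def)
  have "Vector_Spaces.linear s s (inv_into UNIV \<phi>)"
    by (rule linear_inv[OF \<phi>])
  then show "\<exists>\<psi>\<in>carrier (GL s). \<psi> \<otimes>\<^bsub>GL s\<^esub> \<phi> = \<one>\<^bsub>GL s\<^esub>"
    using \<phi>(2) by (intro bexI[of _ "inv_into UNIV \<phi>"])
      (simp_all add: GL_def bij_imp_bij_inv bij_is_inj)
qed (use assms in \<open>auto simp: GL_def bij_comp o_assoc Vector_Spaces.linear_iff\<close>)

lemma inv_GL:
  assumes "vector_space s" "\<phi> \<in> carrier (GL s)"
  shows "inv\<^bsub>GL s\<^esub> \<phi> = inv_into UNIV \<phi>"
proof -
  interpret group "GL s" by (rule group_GL) fact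
  have \<phi>: "Vector_Spaces.linear s s \<phi>" "bij \<phi>"
    using assms(2) by (simp_all add: GL_def)
  have "Vector_Spaces.linear s s (inv_into UNIV \<phi>)"
    by (rule linear_inv[OF \<phi>])
  then show ?thesis
    using \<phi>(2) assms(2)
    by (intro inv_equality) (simp_all add: GL_def bij_imp_bij_inv bij_is_inj)
qed

text \<open>By finiteness two powers of \<phi> coincide, and injectivity cancels the smaller one.
  The order found here feeds the construction of eigenvectors.\<close>

lemma finite_order_of_bij:
  assumes "finite G" "bij \<phi>" "\<And>k. \<phi> ^^ k \<in> G"
  shows "\<exists>m>0. \<phi> ^^ m = id"
proof -
  have "\<not> inj (\<lambda>k. \<phi> ^^ k)"
    using assms(1,3) finite_subset[of "range (\<lambda>k. \<phi> ^^ k)" G] finite_imageD by blast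
  then obtain i j where ij: "i < j" "\<phi> ^^ i = \<phi> ^^ j"
    unfolding inj_on_def by (metis linorder_neqE_nat)
  have "(\<phi> ^^ i) ((\<phi> ^^ (j - i)) x) = (\<phi> ^^ i) x" for x
  proof -
    have "(\<phi> ^^ i) ((\<phi> ^^ (j - i)) x) = (\<phi> ^^ (i + (j - i))) x"
      by (simp only: funpow_add o_apply)
    also have "i + (j - i) = j" using ij(1) by simp
    finally show ?thesis by (simp only: ij(2))
  qed
  then have "\<phi> ^^ (j - i) = id"
    using injD[OF inj_fn[OF bij_is_inj[OF assms(2)], of i]] by (simp add: fun_eq_iff)
  then show ?thesis using ij(1) by (intro exI[of _ "j - i"]) simp
qed

locale finite_group_character = indexed_basis s e
  for s :: "complex \<Rightarrow> 'w::ab_group_add \<Rightarrow> 'w" and e :: "'n::finite \<Rightarrow> 'w" +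
  fixes G :: "('w \<Rightarrow> 'w) set" and c :: "('w \<Rightarrow> 'w) \<Rightarrow> complex"
  assumes subgroup_G: "subgroup G (GL s)" and finite_G: "finite G"
    and hom_c: "c \<in> hom ((GL s)\<lparr>carrier := G\<rparr>) complex_star"
begin

lemma G_linear: "\<phi> \<in> G \<Longrightarrow> Vector_Spaces.linear s s \<phi>"
  and G_bij: "\<phi> \<in> G \<Longrightarrow> bij \<phi>"
  using subgroup.subset[OF subgroup_G] by (auto simp: GL_def)

lemma G_id: "id \<in> G"
  using subgroup.one_closed[OF subgroup_G] by (simp add: GL_def)

lemma G_comp: "\<phi> \<in> G \<Longrightarrow> \<psi> \<in> G \<Longrightarrow> \<phi> \<circ> \<psi> \<in> G"
  using subgroup.m_closed[OF subgroup_G] by (simp add: GL_def)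

lemma G_inv_GL: "\<phi> \<in> G \<Longrightarrow> inv\<^bsub>GL s\<^esub> \<phi> = inv_into UNIV \<phi>"
  using inv_GL[OF vector_space_axioms] subgroup.subset[OF subgroup_G] by blast

lemma G_inv: "\<phi> \<in> G \<Longrightarrow> inv_into UNIV \<phi> \<in> G"
  using subgroup.m_inv_closed[OF subgroup_G] G_inv_GL by metis

lemma c_comp: "\<phi> \<in> G \<Longrightarrow> \<psi> \<in> G \<Longrightarrow> c (\<phi> \<circ> \<psi>) = c \<phi> * c \<psi>"
  using hom_c by (simp add: hom_def GL_def complex_star_def)

lemma card_G: "card G \<noteq> 0"
  using finite_G G_id by auto

lemma G_finite_order:
  assumes "\<phi> \<in> G"
  shows "\<exists>m>0. \<phi> ^^ m = id"
proof (rule finite_order_of_bij[OF finite_G G_bij[OF assms]])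
  show "\<phi> ^^ k \<in> G" for k
    by (induction k) (simp_all only: funpow.simps G_id G_comp assms)
qed

lemma pushforward_comp:
  assumes "\<phi> \<in> G" "\<psi> \<in> G"
  shows "pushforward \<phi> (pushforward \<psi> v) = pushforward (\<phi> \<circ> \<psi>) v"
  by (simp add: pushforward_def o_inv_distrib[OF G_bij G_bij] assms o_assoc)

lemma pushforward_linear:
  assumes "\<phi> \<in> G"
  shows "Vector_Spaces.linear (fscale s) (fscale s) (pushforward \<phi>)"
  unfolding Vector_Spaces.linear_iff
  using fld.vector_space_axioms pushforward_add[OF G_linear[OF assms]]
    pushforward_scale[OF G_linear[OF assms]] by blast

text \<open>The Reynolds operator twisted by the character.\<close>

definition reynolds :: "('w \<Rightarrow> 'w) \<Rightarrow> 'w \<Rightarrow> 'w"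
  where "reynolds v =
    (\<Sum>\<phi>\<in>G. fscale s (c \<phi> / of_nat (card G)) (pushforward (inv_into UNIV \<phi>) v))"

lemma reynolds_equivariant:
  assumes "\<psi> \<in> G"
  shows "pushforward \<psi> (reynolds v) = fscale s (c \<psi>) (reynolds v)"
proof -
  interpret \<psi>: Vector_Spaces.linear "fscale s" "fscale s" "pushforward \<psi>"
    by (rule pushforward_linear) fact
  have inv_comp: "\<psi> \<circ> inv_into UNIV (\<phi> \<circ> \<psi>) = inv_into UNIV \<phi>" if "\<phi> \<in> G" for \<phi>
    using G_bij[OF assms] G_bij[OF that]
    by (simp add: o_inv_distrib fun_eq_iff bij_is_surj surj_f_inv_f)
  have "pushforward \<psi> (reynolds v) =
      (\<Sum>\<phi>\<in>G. fscale s (c \<phi> / of_nat (card G)) (pushforward (\<psi> \<circ> inv_into UNIV \<phi>) v))"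
    by (simp add: reynolds_def \<psi>.sum \<psi>.scale pushforward_comp assms G_inv)
  \<comment> \<open>Right translation by \<psi> permutes \<open>G\<close>. After it the inverse of
    \<open>\<phi> \<circ> \<psi>\<close> absorbs \<psi>, and multiplicativity of \<open>c\<close>
    releases the factor \<open>c \<psi>\<close>.\<close>
  also have "\<dots> = (\<Sum>\<phi>\<in>G. fscale s (c (\<phi> \<circ> \<psi>) / of_nat (card G))
      (pushforward (\<psi> \<circ> inv_into UNIV (\<phi> \<circ> \<psi>)) v))"
    by (rule sum.reindex_bij_witness[of _ "\<lambda>\<phi>. \<phi> \<circ> \<psi>" "\<lambda>\<phi>. \<phi> \<circ> inv_into UNIV \<psi>"])
      (simp_all add: assms G_comp G_inv o_assoc[symmetric] bij_is_inj bij_is_surj surj_iff[THEN iffD1] G_bij)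
  also have "\<dots> = fscale s (c \<psi>) (reynolds v)"
    by (simp add: reynolds_def fld.scale_sum_right c_comp assms inv_comp mult.commute)
  finally show ?thesis .
qed

lemma reynolds_fixes_semi_invariants:
  assumes "\<And>\<phi>. \<phi> \<in> G \<Longrightarrow> pushforward \<phi> v = fscale s (c \<phi>) v"
  shows "reynolds v = v"
proof -
  have "fscale s (c \<phi> / of_nat (card G)) (pushforward (inv_into UNIV \<phi>) v) = fscale s (1 / of_nat (card G)) v"
    if \<phi>: "\<phi> \<in> G" for \<phi>
  proof -
    \<comment> \<open>Moving the scalar inside turns \<open>c \<phi>\<close> times v into the
      pushforward of v by \<phi>, so no reciprocal of \<open>c \<phi>\<close> is formed.\<close>
    have "fscale s (c \<phi>) (pushforward (inv_into UNIV \<phi>) v) = pushforward (inv_into UNIV \<phi>) (pushforward \<phi> v)"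
      using \<phi> by (simp add: assms pushforward_scale[OF G_linear] G_inv)
    also have "\<dots> = v"
      using \<phi> by (simp add: pushforward_comp G_inv bij_is_inj G_bij) (simp add: pushforward_def)
    finally have "fscale s (1 / of_nat (card G)) (fscale s (c \<phi>) (pushforward (inv_into UNIV \<phi>) v)) =
        fscale s (1 / of_nat (card G)) v"
      by simp
    then show ?thesis by simp
  qed
  then have "reynolds v = (\<Sum>\<phi>\<in>G. fscale s (1 / of_nat (card G)) v)"
    by (simp add: reynolds_def)
  also have "\<dots> = v"
    using card_G by (simp add: fld.sum_constant_scale del: sum_constant)
  finally show ?thesis .
qed

section \<open>Projection onto divergence-free semi-invariants\<close>

lemma subspace_div_free: "fld.subspace (div_free s e d)"
  by (rule fld.subspaceI)
    (auto simp: div_free_def fld.subspace_0 fld.subspace_add fld.subspace_scale subspace_hom_field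
      divergence_zero divergence_add[of _ d] divergence_scale[of _ d] fscale_apply)

lemma pushforward_div_free:
  assumes "\<phi> \<in> G" "v \<in> div_free s e d"
  shows "pushforward \<phi> v \<in> div_free s e d"
  using assms pushforward_hom_field[of v d \<phi>] divergence_pushforward[of v d \<phi>]
  by (simp add: div_free_def G_linear G_bij)

lemma reynolds_semi_invariants:
  assumes "v \<in> div_free s e d"
  shows "reynolds v \<in> semi_invariants s G c (div_free s e) d"
proof -
  have "reynolds v \<in> div_free s e d"
    unfolding reynolds_def
    by (intro fld.subspace_sum fld.subspace_scale subspace_div_free pushforward_div_free G_inv assms)
  then show ?thesis
    by (simp add: semi_invariants_def reynolds_equivariant)
qed

lemma subspace_semi_invariants: "fld.subspace (semi_invariants s G c (div_free s e) d)"
proof -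
  note S = subspace_div_free[of d]
  have zero: "pushforward \<phi> 0 = 0" if "\<phi> \<in> G" for \<phi>
  proof -
    interpret \<phi>: Vector_Spaces.linear "fscale s" "fscale s" "pushforward \<phi>"
      by (rule pushforward_linear) fact
    show ?thesis by simp
  qed
  show ?thesis
    using fld.subspace_0[OF S] fld.subspace_add[OF S] fld.subspace_scale[OF S]
    by (intro fld.subspaceI)
      (auto simp: semi_invariants_def zero pushforward_add[OF G_linear] pushforward_scale[OF G_linear]
        fld.scale_right_distrib mult.commute)
qed

text \<open>A right inverse of the divergence. Here d is the degree of the resulting field, so f has
  degree d - 1; in degree 0 the fields are constant and there is nothing to correct.\<close>

definition euler_part :: "nat \<Rightarrow> ('w \<Rightarrow> complex) \<Rightarrow> 'w \<Rightarrow> 'w"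
  where "euler_part d f = (case d of 0 \<Rightarrow> 0
    | Suc d' \<Rightarrow> euler (fscale (*) (1 / of_nat (d' + CARD('n))) f))"

definition div_free_part :: "nat \<Rightarrow> ('w \<Rightarrow> 'w) \<Rightarrow> 'w \<Rightarrow> 'w"
  where "div_free_part d v = v - euler_part d (divergence s e v)"

lemma divergence_euler_part:
  assumes "f \<in> hom_poly s d"
  shows "divergence s e (euler_part (Suc d) f) = f"
proof -
  \<comment> \<open>The index type is nonempty, so the denominator is positive even for d =
    0.\<close>
  have "of_nat d + of_nat CARD('n) \<noteq> (0 :: complex)"
    by (simp flip: of_nat_add)
  then show ?thesis
    unfolding euler_part_def
    by (simp add: divergence_euler[OF fn.subspace_scale[OF subspace_hom_poly assms]])
qed

lemma euler_part_hom_field: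
  "f \<in> hom_poly s d \<Longrightarrow> euler_part (Suc d) f \<in> hom_field s (Suc d)"
  by (simp add: euler_part_def euler_hom_field fn.subspace_scale subspace_hom_poly)

lemma euler_part_add: "euler_part d (f + g) = euler_part d f + euler_part d g"
  and euler_part_scale: "euler_part d (fscale (*) a f) = fscale s a (euler_part d f)"
  by (auto simp: euler_part_def euler_def fscale_apply fun_eq_iff scale_left_distrib
      add_divide_distrib mult.commute split: nat.split)

lemma pushforward_euler_part:
  assumes "\<phi> \<in> G"
  shows "pushforward (inv_into UNIV \<phi>) (euler_part d f) = euler_part d (f \<circ> \<phi>)"
proof -
  note G = G_linear[OF G_inv[OF assms]] G_bij[OF G_inv[OF assms]]
  have "pushforward (inv_into UNIV \<phi>) 0 = 0"
    using pushforward_scale[OF G(1), of 0 0] by simp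
  then show ?thesis
    by (auto simp: euler_part_def pushforward_euler[OF G] inv_inv_eq[OF G_bij[OF assms]]
        fscale_def o_def split: nat.split)
qed

lemma div_free_part:
  assumes "v \<in> hom_field s d"
  shows "div_free_part d v \<in> div_free s e d"
proof (cases d)
  case 0
  then show ?thesis
    using assms dirderiv_hom_poly_0[OF coord_hom_field]
    by (simp add: div_free_part_def euler_part_def div_free_def divergence_eq_sum_dirderiv)
next
  case (Suc d')
  let ?f = "divergence s e v"
  have f: "?f \<in> hom_poly s d'"
    using assms Suc by (simp add: divergence_hom_poly)
  have E: "euler_part d ?f \<in> hom_field s d"
    using euler_part_hom_field[OF f] Suc by simp
  have "div_free_part d v = v + fscale s (- 1) (euler_part d ?f)"
    by (simp add: div_free_part_def)
  then have "divergence s e (div_free_part d v) =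
      ?f + fscale (*) (- 1) (divergence s e (euler_part d ?f))"
    by (simp only: divergence_add[OF assms fld.subspace_scale[OF subspace_hom_field E]]
        divergence_scale[OF E])
  also have "\<dots> = 0"
    by (simp add: Suc divergence_euler_part[OF f])
  finally show ?thesis
    using assms E by (simp add: div_free_def div_free_part_def fld.subspace_diff[OF subspace_hom_field])
qed

lemma div_free_part_fixes:
  assumes "v \<in> div_free s e d"
  shows "div_free_part d v = v"
proof -
  have "divergence s e v = 0"
    using assms by (simp add: div_free_def fun_eq_iff)
  then show ?thesis
    using euler_part_scale[of d 0 0] by (simp add: div_free_part_def)
qed

text \<open>Writes the projection as a combination, over \<open>G\<close>, of operators whose traces
  are computed separately.\<close>

lemma reynolds_div_free_part:
  "reynolds (div_free_part d v) = (\<Sum>\<phi>\<in>G. fscale s (c \<phi> / of_nat (card G))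
    (pushforward (inv_into UNIV \<phi>) v - euler_part d (divergence s e v \<circ> \<phi>)))"
proof -
  have "pushforward (inv_into UNIV \<phi>) (div_free_part d v) =
      pushforward (inv_into UNIV \<phi>) v - euler_part d (divergence s e v \<circ> \<phi>)" if "\<phi> \<in> G" for \<phi>
  proof -
    interpret \<phi>: Vector_Spaces.linear "fscale s" "fscale s" "pushforward (inv_into UNIV \<phi>)"
      by (rule pushforward_linear[OF G_inv[OF that]])
    show ?thesis
      by (simp add: div_free_part_def \<phi>.diff pushforward_euler_part[OF that])
  qed
  then show ?thesis by (simp add: reynolds_def)
qed

text \<open>The operator factors through polynomials of degree d - 1. In the reversed composition
  the divergence cancels \<open>euler_part\<close>, and only composition with \<phi> is
  left.\<close>

lemma trace_euler_part:
  assumes "\<phi> \<in> G"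
  shows "fld.trace_wrt (monomial_field ` (weak_compositions UNIV d \<times> UNIV))
      (\<lambda>v. euler_part d (divergence s e v \<circ> \<phi>)) =
    (case d of 0 \<Rightarrow> 0 | Suc d' \<Rightarrow> fn.trace_wrt (monomial ` weak_compositions UNIV d') (\<lambda>f. f \<circ> \<phi>))"
proof (cases d)
  case 0
  have "fld.representation B 0 b = 0" for B b
    by (simp add: fld.representation_zero)
  then show ?thesis
    by (simp add: 0 euler_part_def fld.trace_wrt_def)
next
  case (Suc d')
  have fin: "finite (weak_compositions (UNIV :: 'n set) k)" for k
    by (simp add: finite_weak_compositions)
  have "fld.trace_wrt (monomial_field ` (weak_compositions UNIV (Suc d') \<times> UNIV))
      (\<lambda>v. euler_part (Suc d') (divergence s e v \<circ> \<phi>)) =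
    fn.trace_wrt (monomial ` weak_compositions UNIV d')
      (\<lambda>f. divergence s e (euler_part (Suc d') f) \<circ> \<phi>)"
  proof (rule fld_fn.trace_wrt_cyclic[where f = "\<lambda>v. divergence s e v \<circ> \<phi>" and g = "euler_part (Suc d')"],
      unfold hom_field_eq_span[symmetric] hom_poly_eq_span[symmetric])
    show "divergence s e v \<circ> \<phi> \<in> hom_poly s d'" if "v \<in> hom_field s (Suc d')" for v
      using that by (intro hom_poly_compose divergence_hom_poly G_linear assms)
    show "divergence s e (u + v) \<circ> \<phi> = (divergence s e u \<circ> \<phi>) + (divergence s e v \<circ> \<phi>)"
      if "u \<in> hom_field s (Suc d')" "v \<in> hom_field s (Suc d')" for u v
      unfolding divergence_add[OF that] by (simp add: fun_eq_iff)
    show "divergence s e (fscale s a v) \<circ> \<phi> = fscale (*) a (divergence s e v \<circ> \<phi>)"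
      if "v \<in> hom_field s (Suc d')" for a v
      unfolding divergence_scale[OF that] by (simp add: fun_eq_iff fscale_apply)
  qed (simp_all add: independent_monomial_fields independent_monomials fin
      euler_part_hom_field euler_part_add euler_part_scale)
  also have "\<dots> = fn.trace_wrt (monomial ` weak_compositions UNIV d') (\<lambda>f. f \<circ> \<phi>)"
    by (rule fn.trace_wrt_cong) (auto simp: divergence_euler_part monomial_hom_poly)
  finally show ?thesis by (simp add: Suc)
qed

lemma dim_semi_invariants:
  "of_nat (fld.dim (semi_invariants s G c (div_free s e) d)) =
    (\<Sum>\<phi>\<in>G. c \<phi> / of_nat (card G) *
      fps_nth ((fps_const (trace (matrix_of s e (inv_into UNIV \<phi>))) - fps_X) /
        det_one_minus (matrix_of s e \<phi>)) d)"
proof -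
  let ?B = "monomial_field ` (weak_compositions (UNIV :: 'n set) d \<times> UNIV)"
  let ?T = "\<lambda>\<phi> v. pushforward (inv_into UNIV \<phi>) v - euler_part d (divergence s e v \<circ> \<phi>)"
  have B: "fld.independent ?B" "finite ?B" "fld.span ?B = hom_field s d"
    by (simp_all add: independent_monomial_fields finite_weak_compositions hom_field_eq_span)
  have euler: "euler_part d (divergence s e v \<circ> \<phi>) \<in> hom_field s d"
    if "v \<in> hom_field s d" "\<phi> \<in> G" for v \<phi>
  proof (cases d)
    case 0
    then show ?thesis by (simp add: euler_part_def fld.subspace_0 subspace_hom_field)
  next
    case (Suc d')
    with that show ?thesis
      by (simp add: euler_part_hom_field hom_poly_compose divergence_hom_poly G_linear)
  qed
  have push: "pushforward (inv_into UNIV \<phi>) v \<in> hom_field s d"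
    if "v \<in> hom_field s d" "\<phi> \<in> G" for v \<phi>
    using that by (simp add: pushforward_hom_field G_linear G_bij G_inv)
  have T_add: "?T \<phi> (u + v) = ?T \<phi> u + ?T \<phi> v"
    if "u \<in> hom_field s d" "v \<in> hom_field s d" "\<phi> \<in> G" for u v \<phi>
  proof -
    have "divergence s e (u + v) \<circ> \<phi> = (divergence s e u \<circ> \<phi>) + (divergence s e v \<circ> \<phi>)"
      using that by (simp add: divergence_add fun_eq_iff)
    then show ?thesis
      using that by (simp add: pushforward_add[OF G_linear[OF G_inv]] euler_part_add)
  qed
  have T_scale: "?T \<phi> (fscale s a v) = fscale s a (?T \<phi> v)"
    if "v \<in> hom_field s d" "\<phi> \<in> G" for a v \<phi>
  proof -
    have "divergence s e (fscale s a v) \<circ> \<phi> = fscale (*) a (divergence s e v \<circ> \<phi>)"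
      using that by (simp add: divergence_scale fun_eq_iff fscale_apply)
    then show ?thesis
      using that by (simp add: pushforward_scale[OF G_linear[OF G_inv]] euler_part_scale
          fld.scale_right_diff_distrib)
  qed
  have sub: "semi_invariants s G c (div_free s e) d \<subseteq> hom_field s d"
    by (auto simp: semi_invariants_def div_free_def)
  have "of_nat (fld.dim (semi_invariants s G c (div_free s e) d)) =
      fld.trace_wrt ?B (\<lambda>v. reynolds (div_free_part d v))"
  \<comment> \<open>The composite lands in the semi-invariants because averaging preserves zero
    divergence, and it fixes them because both factors do.\<close>
  proof (rule fld.trace_wrt_projection[symmetric, OF B(1,2) subspace_semi_invariants])
    show "reynolds (div_free_part d v) = v" if "v \<in> semi_invariants s G c (div_free s e) d" for v
      using that by (simp add: semi_invariants_def div_free_part_fixes reynolds_fixes_semi_invariants)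
    show "reynolds (div_free_part d (u + v)) =
        reynolds (div_free_part d u) + reynolds (div_free_part d v)"
      if "u \<in> fld.span ?B" "v \<in> fld.span ?B" for u v
      using that unfolding B(3) reynolds_div_free_part
      by (simp only: T_add fld.scale_right_distrib sum.distrib cong: sum.cong)
    show "reynolds (div_free_part d (fscale s a v)) = fscale s a (reynolds (div_free_part d v))"
      if "v \<in> fld.span ?B" for a v
      using that unfolding B(3) reynolds_div_free_part
      by (simp only: T_scale fld.scale_sum_right fld.scale_left_commute cong: sum.cong)
  qed (use sub in \<open>auto simp: B(3) intro!: reynolds_semi_invariants div_free_part\<close>)
  also have "\<dots> = (\<Sum>\<phi>\<in>G. c \<phi> / of_nat (card G) * fld.trace_wrt ?B (?T \<phi>))"
    unfolding reynolds_div_free_part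
  proof (rule fld.trace_wrt_sum[OF B(1)])
    fix \<phi> b assume "\<phi> \<in> G" "b \<in> ?B"
    then show "?T \<phi> b \<in> fld.span ?B"
      using fld.span_base[of b ?B] unfolding B(3)
      by (intro fld.subspace_diff subspace_hom_field push euler)
  qed
  also have "\<dots> = (\<Sum>\<phi>\<in>G. c \<phi> / of_nat (card G) *
      fps_nth ((fps_const (trace (matrix_of s e (inv_into UNIV \<phi>))) - fps_X) /
        det_one_minus (matrix_of s e \<phi>)) d)"
  proof (rule sum.cong)
    fix \<phi> assume \<phi>: "\<phi> \<in> G"
    have mem: "b \<in> hom_field s d" if "b \<in> ?B" for b
      using fld.span_base[OF that] B(3) by simp
    have "fld.trace_wrt ?B (?T \<phi>) = fld.trace_wrt ?B (pushforward (inv_into UNIV \<phi>)) -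
        fld.trace_wrt ?B (\<lambda>v. euler_part d (divergence s e v \<circ> \<phi>))"
      by (rule fld.trace_wrt_diff[OF B(1)]) (unfold B(3), (intro push euler mem \<phi>; assumption)+)
    moreover obtain m where "m > 0" "\<phi> ^^ m = id"
      using G_finite_order[OF \<phi>] by blast
    ultimately show "c \<phi> / of_nat (card G) * fld.trace_wrt ?B (?T \<phi>) = c \<phi> / of_nat (card G) *
      fps_nth ((fps_const (trace (matrix_of s e (inv_into UNIV \<phi>))) - fps_X) /
        det_one_minus (matrix_of s e \<phi>)) d"
      using molien_summand_nth[OF G_linear[OF \<phi>] G_bij[OF \<phi>], of m d]
      by (simp only: trace_euler_part[OF \<phi>])
  qed simp
  finally show ?thesis .
qed

end

theorem theorem8p1:
  fixes s :: "complex \<Rightarrow> 'w::ab_group_add \<Rightarrow> 'w"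
    and e :: "'n::finite \<Rightarrow> 'w"
    and G :: "('w \<Rightarrow> 'w) set"
    and c :: "('w \<Rightarrow> 'w) \<Rightarrow> complex"
  assumes "finite_dimensional_vector_space s (range e)" and "inj e"
    and "subgroup G (GL s)" and "finite G"
    and "c \<in> hom ((GL s)\<lparr>carrier := G\<rparr>) complex_star"
  shows "poincare_series (fscale s) (semi_invariants s G c (div_free s e)) =
    fps_const (1 / of_nat (card G)) *
      (\<Sum>\<phi>\<in>G. fps_const (c \<phi>) * (fps_const (trace (matrix_of s e (inv\<^bsub>GL s\<^esub> \<phi>))) - fps_X)
                / det_one_minus (matrix_of s e \<phi>))"
proof -
  interpret finite_dimensional_vector_space s "range e" by fact
  interpret finite_group_character s e G c
    by (intro finite_group_character.intro indexed_basis.intro indexed_basis_axioms.intro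
        finite_group_character_axioms.intro assms)
  have "fps_nth (fps_const (1 / of_nat (card G)) *
      (\<Sum>\<phi>\<in>G. fps_const (c \<phi>) * (fps_const (trace (matrix_of s e (inv\<^bsub>GL s\<^esub> \<phi>))) - fps_X)
                / det_one_minus (matrix_of s e \<phi>))) d =
    of_nat (fld.dim (semi_invariants s G c (div_free s e) d))" for d
  proof -
    \<comment> \<open>The quotient in the statement has \<open>fps_const (c \<phi>)\<close> in its
      numerator; a constant can be taken out whatever the denominator.\<close>
    have "fps_const a * f / g = fps_const a * (f / g)" for a and f g :: "complex fps"
      by (simp add: fps_divide_def Let_def mult.assoc fps_eq_iff)
    then show ?thesis
      by (simp add: dim_semi_invariants fps_sum_nth sum_distrib_left G_inv_GL cong: sum.cong)
  qed
  then show ?thesis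
    by (intro fps_ext) (simp add: poincare_series_def)
qed

end
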